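(* For every integer $m\ge1$ and every rational number $x$, \[ \gamma_{\mathcal{A}}^{\mathrm{K},m}(x)=\gamma_{\mathcal{A}}^{\mathrm{W}}+\delta_{-1}(x+m)-1+(H_m-1)\,\ell_{\mathcal{A}}(x+m+1)+\sum_{j=0}^{m-1}(-1)^{m-j}\binom{m}{j}\frac{\ell_{\mathcal{A}}(x+j+1)}{m-j}\quad\text{in }\mathcal{A}. \]
   Context: $\mathcal{A}\coloneqq\big(\prod_{p\text{ prime}}\mathbb{Z}/p\mathbb{Z}\big)/\big(\bigoplus_{p\text{ prime}}\mathbb{Z}/p\mathbb{Z}\big)$, a $\mathbb{Q}$-algebra via the diagonal embedding of $\mathbb{Q}$ (for the finitely many primes dividing a denominator, the $p$-component is assigned arbitrarily). Gregory polynomials $G_n(x)\in\mathbb{Q}[x]$ are defined by $\frac{t(1+t)^x}{\log(1+t)}=\sum_{n\ge0}G_n(x)t^n$. $H_m=\sum_{j=1}^m1/j$, $(n)_{m+1}=n(n+1)\cdots(n+m)$. For $x\in\mathbb{Q}$, $\ell_{\mathcal{A}}(x)\coloneqq\big(\frac{x^p-x}{p}\bmod p\big)_p$ ($x$ times the Fermat quotient $\frac{x^{p-1}-1}{p}$; $\ell_{\mathcal{A}}(0)=0$). Define $\gamma_{\mathcal{A}}^{\mathrm{K},m}(x)\coloneqq\big(m!\sum_{n=1}^{p-m-1}\frac{(-1)^{n-1}G_n(x)}{(n)_{m+1}}\bmod p\big)_p+H_m-\ell_{\mathcal{A}}(x+m+1)$ and $\gamma_{\mathcal{A}}^{\mathrm{W}}\coloneqq\big(\frac{(p-1)!+1}{p}\bmod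 p\big)_p$. $\delta_{-1}$ is the indicator function of $\{-1\}$. *)

theory Defs
  imports
    "HOL-Computational_Algebra.Computational_Algebra"
    "HOL-Number_Theory.Modular_Inverse"
    "HOL-Library.Indicator_Function"
begin

section \<open>The ring \<open>(\<Prod>\<^sub>p \<int>/p\<int>) / (\<Oplus>\<^sub>p \<int>/p\<int>)\<close>\<close>

text \<open>
  An element of \<open>\<Prod>\<^sub>p \<int>/p\<int>\<close> is represented by a family \<open>f :: nat \<Rightarrow> int\<close>, of which only the
  residues of \<open>f p\<close> modulo \<open>p\<close> for \<open>p\<close> prime matter. Two such families are identified iff
  their difference has finite support, i.e. lies in \<open>\<Oplus>\<^sub>p \<int>/p\<int>\<close>.
\<close>

definition A_rel :: "(nat \<Rightarrow> int) \<Rightarrow> (nat \<Rightarrow> int) \<Rightarrow> bool" where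
  "A_rel f g \<longleftrightarrow> finite {p. prime p \<and> \<not> [f p = g p] (mod int p)}"

lemma A_rel_combine:
  assumes "A_rel f g" "A_rel f' g'"
    and "\<And>p. prime p \<Longrightarrow> [f p = g p] (mod int p) \<Longrightarrow> [f' p = g' p] (mod int p)
           \<Longrightarrow> [h p = k p] (mod int p)"
  shows "A_rel h k"
  using finite_UnI[OF assms(1,2)[unfolded A_rel_def]] unfolding A_rel_def
  by (rule finite_subset[rotated]) (use assms(3) in blast)

lemma A_rel_refl [simp]: "A_rel f f"
  by (simp add: A_rel_def)

lemma equivp_A_rel: "equivp A_rel"
proof (rule equivpI)
  show "reflp A_rel" by (simp add: reflp_def)
  show "symp A_rel" by (simp add: symp_def A_rel_def cong_sym_eq)
  show "transp A_rel"
    by (rule transpI) (erule (1) A_rel_combine, erule (1) cong_trans)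
qed

quotient_type A_ring = "nat \<Rightarrow> int" / A_rel
  by (rule equivp_A_rel)

instantiation A_ring :: comm_ring_1
begin

lift_definition zero_A_ring :: A_ring is "\<lambda>_. 0" .

lift_definition one_A_ring :: A_ring is "\<lambda>_. 1" .

lift_definition plus_A_ring :: "A_ring \<Rightarrow> A_ring \<Rightarrow> A_ring" is "\<lambda>f g p. f p + g p"
  by (erule (1) A_rel_combine) (rule cong_add)

lift_definition minus_A_ring :: "A_ring \<Rightarrow> A_ring \<Rightarrow> A_ring" is "\<lambda>f g p. f p - g p"
  by (erule (1) A_rel_combine) (rule cong_diff)

lift_definition uminus_A_ring :: "A_ring \<Rightarrow> A_ring" is "\<lambda>f p. - f p"
  by (simp add: A_rel_def cong_minus_minus_iff)

lift_definition times_A_ring :: "A_ring \<Rightarrow> A_ring \<Rightarrow> A_ring" is "\<lambda>f g p. f p * g p"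
  by (erule (1) A_rel_combine) (rule cong_mult)

instance
proof
  have "{p::nat. prime p \<and> \<not> [0 = 1] (mod int p)} = {p. prime p}"
    by (intro Collect_cong) (auto simp: cong_iff_dvd_diff)
  then show "(0::A_ring) \<noteq> 1"
    by transfer (simp add: A_rel_def primes_infinite)
qed (transfer; simp add: algebra_simps)+

end

text \<open>
  The reduction modulo a prime \<open>p\<close> of a rational number whose denominator is prime to \<open>p\<close>;
  it has the junk value \<open>0\<close> if \<open>p\<close> divides the denominator.
\<close>

definition rat_mod :: "nat \<Rightarrow> rat \<Rightarrow> int" where
  "rat_mod p q = (case quotient_of q of (a, b) \<Rightarrow> a * modular_inverse (int p) b mod int p)"

lift_definition A_of_family :: "(nat \<Rightarrow> int) \<Rightarrow> A_ring" is "\<lambda>f. f" .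

text \<open>The element \<open>(r p mod p)\<^sub>p\<close> for a family of rational numbers \<open>r p\<close>.\<close>

definition A_mod :: "(nat \<Rightarrow> rat) \<Rightarrow> A_ring" where
  "A_mod r = A_of_family (\<lambda>p. rat_mod p (r p))"

text \<open>The diagonal embedding, which makes \<open>A_ring\<close> a \<open>\<rat>\<close>-algebra.\<close>

definition A_of_rat :: "rat \<Rightarrow> A_ring" where
  "A_of_rat q = A_mod (\<lambda>_. q)"

lemma rat_mod_cong:
  assumes p: "prime p" and pd: "\<not> int p dvd d" and q: "q = of_int n / of_int d"
  shows "[rat_mod p q * d = n] (mod int p)"
proof -
  obtain a b where ab: "quotient_of q = (a, b)" by force
  have b: "b > 0" "coprime a b" "q = of_int a / of_int b"
    using quotient_of_denom_pos[OF ab] quotient_of_coprime[OF ab] quotient_of_div[OF ab] by auto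
  have "d \<noteq> 0" using pd by auto
  then have "(of_int (a * d) :: rat) = of_int (n * b)"
    using b q by (simp add: field_simps)
  then have eq: "a * d = n * b" by (simp only: of_int_eq_iff)
  have "b dvd a * d" using eq by simp
  then have "b dvd d"
    using b(2) by (simp add: coprime_dvd_mult_right_iff coprime_commute)
  with pd have "\<not> int p dvd b" by (meson dvd_trans)
  then have cop: "coprime b (int p)"
    using prime_imp_coprime[of "int p" b] p by (simp add: coprime_commute)
  have "[rat_mod p q * d = a * modular_inverse (int p) b * d] (mod int p)"
    by (intro cong_mult) (simp_all add: rat_mod_def ab)
  also have "a * modular_inverse (int p) b * d = n * (modular_inverse (int p) b * b)"
    using eq by (simp add: ac_simps)
  also have "[\<dots> = n * 1] (mod int p)"
    by (intro cong_mult cong_refl cong_modular_inverse2 cop)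
  finally show ?thesis by simp
qed

lemma finite_prime_dvd:
  assumes "(d::int) \<noteq> 0"
  shows "finite {p::nat. prime p \<and> int p dvd d}"
proof (rule finite_subset)
  show "{p::nat. prime p \<and> int p dvd d} \<subseteq> {..nat \<bar>d\<bar>}"
  proof
    fix p :: nat assume "p \<in> {p. prime p \<and> int p dvd d}"
    then have "int p dvd d" by simp
    from dvd_imp_le_int[OF assms this] show "p \<in> {..nat \<bar>d\<bar>}" by simp
  qed
qed simp

lemma A_of_family_eqI:
  assumes "d \<noteq> 0"
    and "\<And>p. prime p \<Longrightarrow> \<not> int p dvd d \<Longrightarrow> [f p * d = g p * d] (mod int p)"
  shows "A_of_family f = A_of_family g"
proof -
  have "{p. prime p \<and> \<not> [f p = g p] (mod int p)} \<subseteq> {p. prime p \<and> int p dvd d}"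
  proof clarify
    fix p :: nat assume p: "prime p" "\<not> [f p = g p] (mod int p)"
    show "int p dvd d"
    proof (rule ccontr)
      assume n: "\<not> int p dvd d"
      then have "coprime d (int p)"
        using prime_imp_coprime[of "int p" d] p by (simp add: coprime_commute)
      with assms(2)[OF p(1) n] p(2) show False by (simp add: cong_mult_rcancel)
    qed
  qed
  then have "A_rel f g"
    unfolding A_rel_def by (rule finite_subset) (rule finite_prime_dvd[OF assms(1)])
  then show ?thesis by transfer
qed

lemma A_of_family_add: "A_of_family f + A_of_family g = A_of_family (\<lambda>p. f p + g p)"
  by transfer simp

lemma A_of_family_mult: "A_of_family f * A_of_family g = A_of_family (\<lambda>p. f p * g p)"
  by transfer simp

lemma rat_common_denom:
  fixes x y :: rat
  obtains m n d :: int where "d \<noteq> 0" "x = of_int m / of_int d" "y = of_int n / of_int d"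
proof -
  obtain a b where ab: "quotient_of x = (a, b)" by force
  obtain a' b' where ab': "quotient_of y = (a', b')" by force
  have "b > 0" "b' > 0" "x = of_int a / of_int b" "y = of_int a' / of_int b'"
    using ab ab' quotient_of_denom_pos quotient_of_div by blast+
  then show ?thesis by (intro that[of "b * b'" "a * b'" "a' * b"]) auto
qed

lemma A_of_rat_1 [simp]: "A_of_rat 1 = 1"
proof -
  have "A_of_rat 1 = A_of_family (\<lambda>_. 1)"
    unfolding A_of_rat_def A_mod_def
    using rat_mod_cong[of _ 1 1 1] by (intro A_of_family_eqI[of 1]) simp_all
  then show ?thesis by (simp add: one_A_ring_def A_of_family_def)
qed

lemma A_of_rat_0 [simp]: "A_of_rat 0 = 0"
proof -
  have "A_of_rat 0 = A_of_family (\<lambda>_. 0)"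
    unfolding A_of_rat_def A_mod_def
    using rat_mod_cong[of _ 1 0 0] by (intro A_of_family_eqI[of 1]) simp_all
  then show ?thesis by (simp add: zero_A_ring_def A_of_family_def)
qed

lemma A_of_rat_add: "A_of_rat (x + y) = A_of_rat x + A_of_rat y"
proof -
  obtain m n d :: int where
    *: "d \<noteq> 0" "x = of_int m / of_int d" "y = of_int n / of_int d"
    by (rule rat_common_denom)
  show ?thesis unfolding A_of_rat_def A_mod_def A_of_family_add
  proof (rule A_of_family_eqI[OF *(1)])
    fix p :: nat assume p: "prime p" "\<not> int p dvd d"
    have "x + y = of_int (m + n) / of_int d" using * by (simp add: add_divide_distrib)
    from cong_trans[OF rat_mod_cong[OF p this]
        cong_sym[OF cong_add[OF rat_mod_cong[OF p *(2)] rat_mod_cong[OF p *(3)]]]]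
    show "[rat_mod p (x + y) * d = (rat_mod p x + rat_mod p y) * d] (mod int p)"
      by (simp only: distrib_right)
  qed
qed

lemma A_of_rat_mult: "A_of_rat (x * y) = A_of_rat x * A_of_rat y"
proof -
  obtain m n d :: int where
    *: "d \<noteq> 0" "x = of_int m / of_int d" "y = of_int n / of_int d"
    by (rule rat_common_denom)
  show ?thesis unfolding A_of_rat_def A_mod_def A_of_family_mult
  proof (rule A_of_family_eqI[of "d * d"])
    fix p :: nat assume p: "prime p" "\<not> int p dvd d * d"
    then have pd: "\<not> int p dvd d" by (meson dvd_mult2)
    have "x * y = of_int (m * n) / of_int (d * d)" using * by simp
    from cong_trans[OF rat_mod_cong[OF p this]
        cong_sym[OF cong_mult[OF rat_mod_cong[OF p(1) pd *(2)] rat_mod_cong[OF p(1) pd *(3)]]]]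
    show "[rat_mod p (x * y) * (d * d) = rat_mod p x * rat_mod p y * (d * d)] (mod int p)"
      by (simp only: ac_simps)
  qed (use * in simp)
qed

lemma inj_A_of_rat: "inj A_of_rat"
proof (rule injI, rule ccontr)
  fix x y assume xy: "A_of_rat x = A_of_rat y" "x \<noteq> y"
  have "A_of_rat (x - y) + A_of_rat y = A_of_rat x" by (simp flip: A_of_rat_add)
  then have "A_of_rat (x - y) = 0" using xy by simp
  then have "A_of_rat ((x - y) * inverse (x - y)) = 0" by (simp only: A_of_rat_mult mult_zero_left)
  then show False using xy by simp
qed


section \<open>Gregory polynomials\<close>

text \<open>
  \<open>gregory_poly n\<close> is the \<open>G\<^sub>n \<in> \<rat>[x]\<close> with \<open>t (1 + t)\<^sup>x / log (1 + t) = \<Sum>n. G\<^sub>n(x) t\<^sup>n\<close>. Here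
  \<open>fps_binomial x\<close> is \<open>(1 + t)\<^sup>x\<close> and \<open>fps_ln 1\<close> is \<open>log (1 + t)\<close>. The generating function identity is
  required for every rational \<open>x\<close>, which determines the polynomial.
\<close>

definition gregory_poly :: "nat \<Rightarrow> rat poly" where
  "gregory_poly n =
     (THE G. \<forall>x. poly G x = fps_nth (fps_X * fps_binomial x / fps_ln 1) n)"

lemma subdegree_fps_ln: "subdegree (fps_ln 1 :: rat fps) = 1"
  by (rule subdegreeI) (auto simp: fps_ln_nth)

lemma ex1_gregory_poly:
  "\<exists>!G. \<forall>x. poly G x = fps_nth (fps_X * fps_binomial x / fps_ln (1::rat)) n"
proof -
  define u :: "rat fps" where "u = inverse (unit_factor (fps_ln 1))"
  have eq: "fps_X * fps_binomial x / fps_ln 1 = fps_binomial x * u" for x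
  proof -
    have "fps_X * fps_binomial x / fps_ln 1 = fps_shift 1 (fps_X * (fps_binomial x * u))"
      unfolding fps_divide_def subdegree_fps_ln u_def by (simp add: mult.assoc)
    also have "\<dots> = fps_binomial x * u" by (simp add: fps_eq_iff)
    finally show ?thesis .
  qed
  define B :: "nat \<Rightarrow> rat poly"
    where "B k = smult (1 / fact k) (\<Prod>i=0..<k. [:- of_nat i, 1:])" for k
  have B: "poly (B k) x = x gchoose k" for k x
    by (simp add: B_def gbinomial_prod_rev poly_prod)
  define G where "G = (\<Sum>k=0..n. smult (fps_nth u (n - k)) (B k))"
  have G: "\<forall>x. poly G x = fps_nth (fps_X * fps_binomial x / fps_ln 1) n"
    unfolding eq by (auto simp: G_def fps_mult_nth poly_sum B intro!: sum.cong)
  show ?thesis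
  proof (rule ex1I[of _ G])
    fix G' assume "\<forall>x. poly G' x = fps_nth (fps_X * fps_binomial x / fps_ln (1::rat)) n"
    with G have "poly G' = poly G" by auto
    then show "G' = G" by (simp add: poly_eq_poly_eq_iff)
  qed (rule G)
qed

lemma gregory_poly_gf:
  "Abs_fps (\<lambda>n. poly (gregory_poly n) x) = fps_X * fps_binomial x / fps_ln 1"
  using theI'[OF ex1_gregory_poly] by (simp add: fps_eq_iff gregory_poly_def)


section \<open>The constants\<close>

definition Harm :: "nat \<Rightarrow> rat" where
  "Harm m = (\<Sum>j=1..m. 1 / of_nat j)"

definition ell_A :: "rat \<Rightarrow> A_ring" where
  "ell_A x = A_mod (\<lambda>p. (x ^ p - x) / of_nat p)"

definition gamma_K :: "nat \<Rightarrow> rat \<Rightarrow> A_ring" where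
  "gamma_K m x =
     A_mod (\<lambda>p. fact m * (\<Sum>n=1..p-m-1. (-1) ^ (n - 1) * poly (gregory_poly n) x
                              / pochhammer (of_nat n) (m + 1)))
     + A_of_rat (Harm m) - ell_A (x + of_nat m + 1)"

definition gamma_W :: A_ring where
  "gamma_W = A_mod (\<lambda>p. (fact (p - 1) + 1) / of_nat p)"

end

theory Submission
  (* In the opposite order, coeff would mean the HOL-Algebra constant. *)
  imports "HOL-Number_Theory.Residues" Defs
begin

text \<open>
  Write \<open>G\<^sub>n\<close> for the Gregory polynomials and \<open>e\<^sub>N\<close> for the coefficients of \<open>(1 + t)\<^sup>m log (1 + t)\<close>. Multiplying
  this series by the generating function of the \<open>G\<^sub>n(x)\<close> gives the exact identity
  \<open>\<Sum>\<^bsub>1 \<le> N \<le> p\<^esub> e\<^sub>N G\<^bsub>p-N\<^esub>(x) = binom(x + m, p - 1)\<close>, whose right hand side is \<open>\<delta>\<^bsub>-1\<^esub>(x + m)\<close> modulo \<open>p\<close>.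
  For \<open>m < N < p\<close> and \<open>n = p - N\<close> one has \<open>e\<^sub>N \<equiv> (-1)\<^bsup>n-1\<^esup> m! / (n)\<^bsub>m+1\<^esub>\<close>, so these terms form the sum
  defining \<open>\<gamma>\<^sup>K\<close>; moreover \<open>e\<^sub>p \<equiv> 1/p + H\<^sub>m\<close>. The terms with \<open>N \<le> m\<close> are evaluated from
  \<open>G\<^bsub>p-1\<^esub>(y) \<equiv> -(\<ell>(y + 2) - \<ell>(y + 1)) - (W - 1 + 1/p)\<close>, where \<open>\<ell>(y) = (y\<^sup>p - y)/p\<close> and \<open>W\<close> is the Wilson
  quotient, by means of \<open>G\<^sub>n(y + 1) - G\<^sub>n(y) = G\<^bsub>n-1\<^esub>(y)\<close>. The congruence for \<open>G\<^bsub>p-1\<^esub>\<close> follows from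
  \<open>G\<^sub>n(y) = \<integral> binom(u, n) du\<close> over \<open>[y, y + 1]\<close>, as the coefficients of \<open>u(u - 1)\<dots>(u - p + 2)\<close> other than
  the constant one alternate between \<open>1\<close> and \<open>-1\<close> modulo \<open>p\<close>.
\<close>

unbundle fps_syntax

section \<open>Rationals modulo a prime\<close>

definition p_integral :: "nat \<Rightarrow> rat \<Rightarrow> bool" where
  "p_integral p q \<longleftrightarrow> (\<exists>a b::int. \<not> int p dvd b \<and> q = of_int a / of_int b)"

text \<open>Meaningful also when \<open>a\<close> and \<open>b\<close> themselves are not \<open>p\<close>-integral.\<close>

definition rat_cong :: "nat \<Rightarrow> rat \<Rightarrow> rat \<Rightarrow> bool" where
  "rat_cong p a b \<longleftrightarrow> p_integral p ((a - b) / of_nat p)"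

locale prime_modulus =
  fixes p :: nat
  assumes prime_p: "prime p"
begin

lemma p_pos: "p > 0"
  using prime_p by (simp add: prime_gt_0_nat)

lemma p_integral_divide_int:
  assumes "p_integral p q" "\<not> int p dvd b"
  shows "p_integral p (q / of_int b)"
proof -
  obtain c d :: int where "\<not> int p dvd d" "q = of_int c / of_int d"
    using assms unfolding p_integral_def by blast
  then show ?thesis
    unfolding p_integral_def using assms(2) prime_p
    by (intro exI[of _ c] exI[of _ "d * b"]) (simp add: prime_dvd_mult_iff)
qed

lemma p_integral_of_int [simp]: "p_integral p (of_int a)"
  unfolding p_integral_def
  by (rule exI[of _ a], rule exI[of _ 1]) (use prime_p not_prime_1 in auto)

lemma p_integral_of_nat [simp]: "p_integral p (of_nat a)"
  using p_integral_of_int[of "int a"] by simp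

lemma p_integral_0 [simp]: "p_integral p 0"
  using p_integral_of_nat[of 0] by simp

lemma p_integral_1 [simp]: "p_integral p 1"
  using p_integral_of_nat[of 1] by simp

lemma p_integral_add:
  assumes "p_integral p x" "p_integral p y"
  shows "p_integral p (x + y)"
proof -
  obtain a b c d :: int where *: "\<not> int p dvd b" "x = of_int a / of_int b"
    "\<not> int p dvd d" "y = of_int c / of_int d"
    using assms unfolding p_integral_def by blast
  then have "b \<noteq> 0" "d \<noteq> 0" by auto
  with * show ?thesis
    unfolding p_integral_def using prime_p
    by (intro exI[of _ "a * d + c * b"] exI[of _ "b * d"])
       (simp add: prime_dvd_mult_iff field_simps)
qed

lemma p_integral_mult:
  assumes "p_integral p x" "p_integral p y"
  shows "p_integral p (x * y)"
proof -
  obtain a b c d :: int where *: "\<not> int p dvd b" "x = of_int a / of_int b"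
    "\<not> int p dvd d" "y = of_int c / of_int d"
    using assms unfolding p_integral_def by blast
  then show ?thesis
    unfolding p_integral_def using prime_p
    by (intro exI[of _ "a * c"] exI[of _ "b * d"]) (simp add: prime_dvd_mult_iff)
qed

lemma p_integral_uminus: "p_integral p x \<Longrightarrow> p_integral p (- x)"
  using p_integral_mult[OF p_integral_of_int[of "-1"], of x] by simp

lemma p_integral_diff: "p_integral p x \<Longrightarrow> p_integral p y \<Longrightarrow> p_integral p (x - y)"
  using p_integral_add[of x "- y"] p_integral_uminus[of y] by simp

lemma p_integral_power: "p_integral p x \<Longrightarrow> p_integral p (x ^ n)"
  by (induction n) (auto intro: p_integral_mult)

lemma p_integral_sum: "(\<And>i. i \<in> A \<Longrightarrow> p_integral p (f i)) \<Longrightarrow> p_integral p (sum f A)"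
  by (induction A rule: infinite_finite_induct) (auto intro: p_integral_add)

lemma p_integral_divide_nat:
  assumes "p_integral p q" "0 < k" "k < p"
  shows "p_integral p (q / of_nat k)"
proof -
  have "\<not> int p dvd int k" using assms by (auto dest: zdvd_imp_le)
  from p_integral_divide_int[OF assms(1) this] show ?thesis by simp
qed

lemma p_integral_divide_nat_prod:
  assumes "p_integral p q" "\<And>i. i \<in> A \<Longrightarrow> 0 < f i \<and> f i < p"
  shows "p_integral p (q / (\<Prod>i\<in>A. of_nat (f i)))"
  using assms(2)
proof (induction A rule: infinite_finite_induct)
  case (insert i A)
  then have "p_integral p (q / (\<Prod>i\<in>A. of_nat (f i)) / of_nat (f i))"
    by (intro p_integral_divide_nat) auto
  then show ?case using insert by (simp add: mult.commute)
qed (use assms(1) in auto)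

lemma p_integral_divide_fact:
  assumes "p_integral p q" "n < p"
  shows "p_integral p (q / fact n)"
  using p_integral_divide_nat_prod[of q "{1..n}" "\<lambda>i. i"] assms by (simp add: fact_prod)

section \<open>Congruence of rationals modulo p\<close>

lemma rat_cong_refl [simp]: "rat_cong p a a"
  by (simp add: rat_cong_def)

lemma rat_cong_sym: "rat_cong p a b \<Longrightarrow> rat_cong p b a"
  unfolding rat_cong_def using p_integral_uminus[of "(a - b) / of_nat p"] by (simp add: diff_divide_distrib add_divide_distrib algebra_simps)

lemma rat_cong_trans [trans]: "rat_cong p a b \<Longrightarrow> rat_cong p b c \<Longrightarrow> rat_cong p a c"
  unfolding rat_cong_def using p_integral_add[of "(a - b) / of_nat p" "(b - c) / of_nat p"]
  by (simp add: diff_divide_distrib add_divide_distrib algebra_simps)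

lemma rat_cong_add: "rat_cong p a b \<Longrightarrow> rat_cong p c d \<Longrightarrow> rat_cong p (a + c) (b + d)"
  unfolding rat_cong_def using p_integral_add[of "(a - b) / of_nat p" "(c - d) / of_nat p"]
  by (simp add: diff_divide_distrib add_divide_distrib algebra_simps)

lemma rat_cong_uminus: "rat_cong p a b \<Longrightarrow> rat_cong p (- a) (- b)"
  using rat_cong_sym[of a b] by (simp add: rat_cong_def)

lemma rat_cong_diff: "rat_cong p a b \<Longrightarrow> rat_cong p c d \<Longrightarrow> rat_cong p (a - c) (b - d)"
  using rat_cong_add[OF _ rat_cong_uminus, of a b c d] by simp

lemma rat_cong_sum: "(\<And>i. i \<in> A \<Longrightarrow> rat_cong p (f i) (g i)) \<Longrightarrow> rat_cong p (sum f A) (sum g A)"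
  by (induction A rule: infinite_finite_induct) (auto intro: rat_cong_add)

lemma rat_cong_mult_left: "rat_cong p a b \<Longrightarrow> p_integral p c \<Longrightarrow> rat_cong p (c * a) (c * b)"
  unfolding rat_cong_def using p_integral_mult[of c "(a - b) / of_nat p"]
  by (simp add: right_diff_distrib)

lemma rat_cong_mult_right: "rat_cong p a b \<Longrightarrow> p_integral p c \<Longrightarrow> rat_cong p (a * c) (b * c)"
  using rat_cong_mult_left[of a b c] by (simp add: mult.commute)

lemma rat_cong_mult:
  "rat_cong p a b \<Longrightarrow> rat_cong p c d \<Longrightarrow> p_integral p b \<Longrightarrow> p_integral p c \<Longrightarrow> rat_cong p (a * c) (b * d)"
  by (rule rat_cong_trans[OF rat_cong_mult_right rat_cong_mult_left])

lemma rat_cong_p_integral: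
  assumes "rat_cong p a b" "p_integral p b"
  shows "p_integral p a"
proof -
  have "a = of_nat p * ((a - b) / of_nat p) + b" using p_pos by simp
  then show ?thesis
    using assms by (metis rat_cong_def p_integral_add p_integral_mult p_integral_of_nat)
qed

lemma rat_cong_power:
  assumes "rat_cong p a b" "p_integral p b"
  shows "rat_cong p (a ^ n) (b ^ n)"
  using assms rat_cong_p_integral[OF assms]
  by (induction n) (auto intro!: rat_cong_mult p_integral_power)

lemma rat_cong_of_int: "[a = b] (mod int p) \<Longrightarrow> rat_cong p (of_int a) (of_int b)"
  by (auto simp: rat_cong_def cong_iff_dvd_diff elim!: dvdE simp flip: of_int_diff)
     (use p_pos in simp)

lemma rat_cong_divide_swap:
  assumes "rat_cong p a b" "p_integral p (1 / a)" "p_integral p (1 / b)" "a \<noteq> 0" "b \<noteq> 0"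
  shows "rat_cong p (1 / a) (1 / b)"
  using rat_cong_mult_left[OF rat_cong_sym[OF assms(1)] p_integral_mult[OF assms(2,3)]] assms(4,5)
  by simp

text \<open>P-integrality excludes the default value 0 of \<open>rat_mod\<close>. Together with
  \<open>cong_of_rat_cong\<close> this links \<open>rat_cong\<close> to the integer congruences that
  define the ring.\<close>

lemma rat_cong_rat_mod:
  assumes "p_integral p x"
  shows "rat_cong p (of_int (rat_mod p x)) x"
proof -
  obtain a b :: int where ab: "\<not> int p dvd b" "x = of_int a / of_int b"
    using assms unfolding p_integral_def by blast
  have "rat_cong p (of_int (rat_mod p x * b)) (of_int a)"
    by (rule rat_cong_of_int[OF rat_mod_cong[OF prime_p ab]])
  then have "rat_cong p (of_int (rat_mod p x * b) * (1 / of_int b)) (of_int a * (1 / of_int b))"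
    by (rule rat_cong_mult_right) (rule p_integral_divide_int, use ab in auto)
  moreover have "b \<noteq> 0" using ab by auto
  ultimately show ?thesis using ab(2) by simp
qed

lemma cong_of_rat_cong:
  assumes "rat_cong p (of_int a) (of_int b)"
  shows "[a = b] (mod int p)"
proof -
  obtain c d :: int where cd: "\<not> int p dvd d" "(of_int a - of_int b) / of_nat p = (of_int c / of_int d :: rat)"
    using assms unfolding rat_cong_def p_integral_def by blast
  then have "d \<noteq> 0" by auto
  with cd(2) p_pos have "(of_int ((a - b) * d) :: rat) = of_int (int p * c)"
    by (simp add: field_simps)
  then have "(a - b) * d = int p * c" by (simp only: of_int_eq_iff)
  then have "int p dvd (a - b) * d" by simp
  with cd(1) prime_p show ?thesis by (simp add: prime_dvd_mult_iff cong_iff_dvd_diff)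
qed

section \<open>Fermat, Wilson and binomial coefficients modulo p\<close>

lemma fermat_int: "[(a::int) ^ p = a] (mod int p)"
proof (cases "int p dvd a")
  case True
  then show ?thesis
    using p_pos by (simp add: cong_iff_dvd_diff dvd_power_le dvd_trans dvd_diff)
next
  case False
  \<comment> \<open>\<open>fermat_theorem\<close> is about natural numbers, so a is replaced by its
    residue k.\<close>
  define k where "k = nat (a mod int p)"
  have k: "[int k = a] (mod int p)" using p_pos by (simp add: k_def)
  then have "\<not> p dvd k" using False by (metis cong_dvd_iff int_dvd_int_iff)
  with prime_p have "[k ^ (p - 1) = 1] (mod p)" by (rule fermat_theorem)
  then have "[int k ^ (p - 1) = 1] (mod int p)"
    by (metis cong_int_iff of_nat_1 of_nat_power)
  then have "[int k ^ (p - 1) * int k = 1 * int k] (mod int p)"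
    by (intro cong_mult) auto
  then have "[int k ^ p = int k] (mod int p)"
    using p_pos by (simp flip: power_Suc2)
  then show ?thesis by (meson k cong_pow cong_sym cong_trans)
qed

lemma rat_cong_fermat:
  assumes "p_integral p x"
  shows "rat_cong p (x ^ p) x"
proof -
  note k = rat_cong_rat_mod[OF assms]
  have "rat_cong p (x ^ p) (of_int (rat_mod p x) ^ p)"
    by (rule rat_cong_power[OF rat_cong_sym[OF k]]) simp
  also have "rat_cong p (of_int (rat_mod p x) ^ p) (of_int (rat_mod p x))"
    using rat_cong_of_int[OF fermat_int] by simp
  also note k
  finally show ?thesis .
qed

lemma rat_cong_wilson: "rat_cong p (fact (p - 1)) (-1)"
  using rat_cong_of_int[OF wilson_theorem[OF prime_p]] by simp

text \<open>Neighbours in row p - 1 of Pascal's triangle add up to an inner entry of row p, which p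
  divides; so the sign alternates, starting from 1.\<close>

lemma rat_cong_choose_pred:
  assumes "k < p"
  shows "rat_cong p (of_nat ((p - 1) choose k)) ((-1) ^ k)"
  using assms
proof (induction k)
  case (Suc k)
  have p: "Suc (p - 1) = p" using p_pos by simp
  have "p dvd (p choose Suc k)"
    using Suc.prems prime_p by (intro dvd_choose_prime) auto
  then have "[int (p choose Suc k) = 0] (mod int p)"
    by (simp add: cong_0_iff)
  from rat_cong_of_int[OF this] have 1: "rat_cong p (of_nat (p choose Suc k)) 0" by simp
  have "p choose Suc k = ((p - 1) choose k) + ((p - 1) choose Suc k)"
    using binomial_Suc_Suc[of "p - 1" k] p by simp
  then have "of_nat ((p - 1) choose Suc k) =
      (of_nat (p choose Suc k) - of_nat ((p - 1) choose k) :: rat)" by simp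
  also have "rat_cong p \<dots> (0 - (-1) ^ k)"
    using Suc by (intro rat_cong_diff 1) auto
  finally show ?case by simp
qed simp

end

section \<open>Binomial polynomials and Gregory polynomials\<close>

text \<open>Polymorphic in the ring: the coefficients are needed as integers, for divisibility by p,
  and as rationals, for integration.\<close>

definition falling_poly :: "nat \<Rightarrow> 'a::comm_ring_1 poly" where
  "falling_poly n = (\<Prod>i<n. [:- of_nat i, 1:])"

lemma falling_poly_Suc: "falling_poly (Suc n) = [:- of_nat n, 1:] * falling_poly n"
  by (simp add: falling_poly_def mult.commute)

lemma coeff_falling_poly_of_int:
  "coeff (falling_poly n :: 'a::comm_ring_1 poly) k = of_int (coeff (falling_poly n) k)"
proof (induction n arbitrary: k)
  case 0
  then show ?case by (simp add: falling_poly_def)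
next
  case (Suc n)
  then show ?case
    by (cases k) (simp_all add: falling_poly_Suc)
qed

lemma degree_falling_poly: "degree (falling_poly n :: 'a::idom poly) = n"
  by (simp add: falling_poly_def degree_prod_eq_sum_degree)

definition gbinomial_poly :: "nat \<Rightarrow> rat poly" where
  "gbinomial_poly n = smult (1 / fact n) (falling_poly n)"

lemma poly_gbinomial_poly [simp]: "poly (gbinomial_poly n) y = y gchoose n"
  by (simp add: gbinomial_poly_def falling_poly_def gbinomial_prod_rev poly_prod
      atLeast0LessThan)

lemma gbinomial_add_one: "((y::rat) + 1) gchoose Suc n = (y gchoose Suc n) + (y gchoose n)"
  by (simp add: gbinomial_Suc_Suc)

lemma poly_eq_0_if_nat_roots:
  assumes "\<And>k::nat. poly (q :: rat poly) (of_nat k) = 0"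
  shows "q = 0"
proof (rule ccontr)
  assume "q \<noteq> 0"
  then have "finite {x. poly q x = 0}" by (rule poly_roots_finite)
  moreover have "range (of_nat :: nat \<Rightarrow> rat) \<subseteq> {x. poly q x = 0}" using assms by auto
  ultimately have "finite (range (of_nat :: nat \<Rightarrow> rat))" by (rule finite_subset[rotated])
  then show False by (simp add: range_inj_infinite inj_def)
qed

lemma poly_gbinomial_pderiv_0: "poly (pderiv (gbinomial_poly (Suc n))) 0 = (-1) ^ n / of_nat (Suc n)"
proof -
  have "(falling_poly (Suc n) :: rat poly) = [:0, 1:] * (\<Prod>i<n. [:- of_nat (Suc i), 1:])"
    by (simp add: falling_poly_def prod.lessThan_Suc_shift del: prod.lessThan_Suc)
  then have "poly (pderiv (gbinomial_poly (Suc n))) 0 = (1 / fact (Suc n)) * (\<Prod>i<n. - of_nat (Suc i))"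
    by (simp add: gbinomial_poly_def pderiv_smult pderiv_mult pderiv_pCons poly_prod)
  also have "(\<Prod>i<n. - of_nat (Suc i) :: rat) = (-1) ^ n * fact n"
    by (induction n) (simp_all add: algebra_simps)
  finally show ?thesis by (simp del: of_nat_Suc)
qed

text \<open>This is \<open>d/dy (1 + t)\<^sup>y = log (1 + t) (1 + t)\<^sup>y\<close>. The difference of both sides is invariant under
  \<open>y \<mapsto> y + 1\<close> by induction, hence constant.\<close>

lemma pderiv_gbinomial_poly:
  "pderiv (gbinomial_poly (Suc n)) =
     (\<Sum>k\<le>n. smult ((-1) ^ k / of_nat (Suc k)) (gbinomial_poly (n - k)))"
proof (induction n)
  case 0
  then show ?case by (simp add: gbinomial_poly_def falling_poly_def pderiv_pCons)
next
  case (Suc n)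
  let ?R = "\<lambda>n. \<Sum>k\<le>n. smult ((-1) ^ k / of_nat (Suc k)) (gbinomial_poly (n - k))"
  define E where "E = pderiv (gbinomial_poly (Suc (Suc n))) - ?R (Suc n)"
  \<comment> \<open>By Pascal's rule, the shift adds to each side of the identity the same side of
    the previous identity, so the induction hypothesis makes E periodic.\<close>
  have step: "poly E (y + 1) = poly E y" for y
  proof -
    have "pcompose (gbinomial_poly (Suc (Suc n))) [:1, 1:] =
        gbinomial_poly (Suc (Suc n)) + gbinomial_poly (Suc n)"
      by (rule poly_ext) (simp add: poly_pcompose gbinomial_add_one add.commute)
    from arg_cong[OF this, of pderiv]
    have "pcompose (pderiv (gbinomial_poly (Suc (Suc n)))) [:1, 1:] =
        pderiv (gbinomial_poly (Suc (Suc n))) + pderiv (gbinomial_poly (Suc n))"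
      by (simp add: pderiv_pcompose pderiv_add pderiv_pCons)
    from arg_cong[OF this, of "\<lambda>q. poly q y"]
    have 1: "poly (pderiv (gbinomial_poly (Suc (Suc n)))) (y + 1) =
        poly (pderiv (gbinomial_poly (Suc (Suc n)))) y + poly (pderiv (gbinomial_poly (Suc n))) y"
      by (simp add: poly_pcompose add.commute)
    have 2: "(y + 1) gchoose (Suc n - k) = (y gchoose (Suc n - k)) + (y gchoose (n - k))"
      if "k \<le> n" for k
      using that by (simp add: Suc_diff_le gbinomial_add_one)
    have "poly (?R (Suc n)) (y + 1) = poly (?R (Suc n)) y + poly (?R n) y"
      by (simp add: poly_sum 2 distrib_left sum.distrib cong: sum.cong_simp)
    with 1 Suc.IH show ?thesis by (simp add: E_def)
  qed
  \<comment> \<open>At 0 only the binomial polynomial of degree 0 survives, that is, the summand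
    with k = \<open>Suc n\<close>.\<close>
  have 0: "poly E 0 = 0"
    by (simp add: E_def poly_sum poly_gbinomial_pderiv_0 gbinomial_0_left if_distrib[of "(*) _"] Suc_diff_le
        cong: if_cong sum.cong_simp)
  have "poly E (of_nat k) = 0" for k
    by (induction k) (use 0 step in \<open>simp_all add: add.commute[of 1]\<close>)
  then have "E = 0" by (rule poly_eq_0_if_nat_roots)
  then show ?case by (simp add: E_def)
qed

text \<open>The integral of \<open>q\<close> from \<open>y\<close> to \<open>y + 1\<close>.\<close>

definition unit_integral :: "rat poly \<Rightarrow> rat \<Rightarrow> rat" where
  "unit_integral q y =
     (\<Sum>k\<le>degree q. coeff q k * (((y + 1) ^ Suc k - y ^ Suc k) / of_nat (Suc k)))"

text \<open>A degree bound in place of the exact degree lets polynomials of different degrees be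
  added termwise.\<close>

lemma unit_integral_altdef:
  assumes "degree q \<le> n"
  shows "unit_integral q y =
     (\<Sum>k\<le>n. coeff q k * (((y + 1) ^ Suc k - y ^ Suc k) / of_nat (Suc k)))"
  unfolding unit_integral_def using assms
  by (intro sum.mono_neutral_left) (auto simp: coeff_eq_0)

lemma unit_integral_smult: "unit_integral (smult c q) y = c * unit_integral q y"
  by (simp add: unit_integral_altdef[of _ "degree q"] degree_smult_le sum_distrib_left mult.assoc)

lemma unit_integral_add: "unit_integral (q + r) y = unit_integral q y + unit_integral r y"
proof -
  define n where "n = max (degree q) (degree r)"
  have "degree q \<le> n" "degree r \<le> n" "degree (q + r) \<le> n"
    by (auto simp: n_def degree_add_le)
  then show ?thesis
    by (simp add: unit_integral_altdef[of _ n] distrib_right add_divide_distrib sum.distrib del: power_Suc of_nat_Suc)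
qed

lemma unit_integral_sum: "unit_integral (sum f A) y = (\<Sum>i\<in>A. unit_integral (f i) y)"
  by (induction A rule: infinite_finite_induct)
     (simp_all add: unit_integral_add, simp_all add: unit_integral_def)

text \<open>The fundamental theorem of calculus: the factor k + 1 in a coefficient of the derivative
  cancels the denominator.\<close>

lemma unit_integral_pderiv: "unit_integral (pderiv q) y = poly q (y + 1) - poly q y"
proof -
  have "unit_integral (pderiv q) y =
      (\<Sum>k\<le>degree q. coeff q (Suc k) * ((y + 1) ^ Suc k - y ^ Suc k))"
    by (subst unit_integral_altdef[of _ "degree q"])
       (auto simp: degree_pderiv coeff_pderiv simp del: of_nat_Suc power_Suc intro!: sum.cong)
  also have "\<dots> = (\<Sum>k\<le>Suc (degree q). coeff q k * ((y + 1) ^ k - y ^ k))"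
    by (subst sum.atMost_Suc_shift) (simp del: power_Suc)
  also have "\<dots> = poly q (y + 1) - poly q y"
    by (simp add: poly_altdef right_diff_distrib sum_subtractf coeff_eq_0)
  finally show ?thesis .
qed

section \<open>The generating function of the Gregory polynomials\<close>

lemma fps_ln_1_neq_0: "fps_ln (1::rat) \<noteq> 0"
  using subdegree_fps_ln by auto

text \<open>The division of power series is exact, because log(1 + t) has order 1 and so divides t
  (1 + t)^x.\<close>

lemma gregory_gf_mult_ln:
  "Abs_fps (\<lambda>n. poly (gregory_poly n) x) * fps_ln 1 = fps_X * fps_binomial x"
proof -
  have "fps_binomial x $ 0 \<noteq> 0" by simp
  then have "fps_binomial x \<noteq> 0" by (metis fps_zero_nth)
  then have "fps_ln (1::rat) dvd fps_X * fps_binomial x"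
    using fps_ln_1_neq_0 by (simp add: fps_dvd_iff subdegree_fps_ln)
  then show ?thesis unfolding gregory_poly_gf by simp
qed


text \<open>Multiplied by log(1 + t), the generating function J of the integrals becomes the
  integral of d/du (1 + t)^u, which is (1 + t)^(y+1) - (1 + t)^y = t (1 + t)^y. Then log(1 + t) is
  cancelled.\<close>

lemma gregory_poly_eq_unit_integral:
  "poly (gregory_poly n) y = unit_integral (gbinomial_poly n) y"
proof -
  define J where "J = Abs_fps (\<lambda>n. unit_integral (gbinomial_poly n) y)"
  have "J * fps_ln 1 = fps_X * fps_binomial y"
  proof (rule fps_ext)
    fix n show "(J * fps_ln 1) $ n = (fps_X * fps_binomial y) $ n"
    proof (cases n)
      case (Suc n')
      have "(fps_ln 1 * J) $ Suc n' = (\<Sum>k\<le>Suc n'. fps_ln 1 $ k * J $ (Suc n' - k))"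
        by (simp add: fps_mult_nth atLeast0AtMost)
      also have "\<dots> = (\<Sum>k\<le>n'. fps_ln 1 $ Suc k * J $ (n' - k))"
        by (subst sum.atMost_Suc_shift) simp
      also have "\<dots> = unit_integral (pderiv (gbinomial_poly (Suc n'))) y"
        by (simp add: J_def fps_ln_nth pderiv_gbinomial_poly unit_integral_sum unit_integral_smult)
      also have "\<dots> = y gchoose n'"
        by (simp add: unit_integral_pderiv gbinomial_add_one)
      finally show ?thesis using Suc by (simp add: mult.commute)
    qed simp
  qed
  then have "Abs_fps (\<lambda>n. poly (gregory_poly n) y) * fps_ln 1 = J * fps_ln 1"
    by (simp add: gregory_gf_mult_ln)
  then have "Abs_fps (\<lambda>n. poly (gregory_poly n) y) = J"
    by (simp only: mult_right_cancel[OF fps_ln_1_neq_0])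
  then show ?thesis by (simp add: J_def fps_eq_iff)
qed

text \<open>Replacing y by y + 1 multiplies the generating function by 1 + t.\<close>

lemma gregory_poly_add_one:
  "poly (gregory_poly (Suc n)) (y + 1) = poly (gregory_poly (Suc n)) y + poly (gregory_poly n) y"
proof -
  let ?F = "\<lambda>y. Abs_fps (\<lambda>n. poly (gregory_poly n) y)"
  have "?F (y + 1) * fps_ln 1 = ((1 + fps_X) * ?F y) * fps_ln 1"
    unfolding mult.assoc gregory_gf_mult_ln
    by (simp add: fps_binomial_add_mult fps_binomial_1 mult_ac)
  then have "?F (y + 1) = (1 + fps_X) * ?F y"
    by (simp only: mult_right_cancel[OF fps_ln_1_neq_0])
  then have "?F (y + 1) $ Suc n = ((1 + fps_X) * ?F y) $ Suc n" by simp
  then show ?thesis by (simp add: distrib_right)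
qed

section \<open>The coefficients of the falling factorial modulo a prime\<close>

context prime_modulus
begin

text \<open>Lagrange's bound for roots modulo p. Dividing by the linear factor of the largest root
  leaves a quotient that vanishes modulo p at the smaller ones, since that factor does not.\<close>

lemma coeffs_dvd_if_roots:
  assumes "degree f \<le> n" "n < p" "\<And>i. i \<le> n \<Longrightarrow> int p dvd poly f (int i)"
  shows "int p dvd coeff f k"
  using assms
proof (induction n arbitrary: f k)
  case 0
  then show ?case by (cases k) (auto elim!: degree_eq_zeroE)
next
  case (Suc n)
  define q where "q = synthetic_div f (int (Suc n))"
  have f: "f = [:- int (Suc n), 1:] * q + [:poly f (int (Suc n)):]"
    unfolding q_def by (rule synthetic_div_correct'[symmetric])
  have "int p dvd poly q (int i)" if "i \<le> n" for i
  proof -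
    have "poly f (int i) = (int i - int (Suc n)) * poly q (int i) + poly f (int (Suc n))"
      by (subst f) (simp add: algebra_simps)
    moreover have "int p dvd poly f (int i)" "int p dvd poly f (int (Suc n))"
      using Suc.prems(3)[of i] Suc.prems(3)[of "Suc n"] that by simp_all
    ultimately have "int p dvd (int i - int (Suc n)) * poly q (int i)"
      by (metis dvd_add_left_iff)
    moreover have "\<not> int p dvd int i - int (Suc n)"
      using zdvd_not_zless[of "int (Suc n) - int i" "int p"] Suc.prems(2) that
      by (simp add: dvd_diff_commute)
    ultimately show ?thesis using prime_p by (simp add: prime_dvd_mult_iff)
  qed
  then have q: "int p dvd coeff q k" for k
    using Suc.IH[of q] Suc.prems by (simp add: q_def degree_synthetic_div)
  have "int p dvd poly f (int (Suc n))" using Suc.prems(3)[of "Suc n"] by simp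
  then show ?case by (subst f, cases k) (auto simp: q coeff_pCons)
qed

text \<open>The comparison polynomial is s(u), the sum of (-u)^k over 0 < k < p. Both have degree at
  most p - 1 and agree modulo p at the p points 0, ..., p - 1.\<close>

lemma coeff_falling_poly_pred:
  assumes "p > 2" "0 < k" "k < p"
  shows "[coeff (falling_poly (p - 1)) k = (-1) ^ k] (mod int p)"
proof -
  have odd: "odd p" using prime_p assms(1) prime_odd_nat by blast
  define s :: "int poly" where "s = (\<Sum>k\<in>{1..<p}. monom ((-1) ^ k) k)"
  define f where "f = falling_poly (p - 1) - s"
  have poly_s: "poly s i = (\<Sum>k\<in>{1..<p}. (-i) ^ k)" for i
    unfolding s_def poly_sum by (intro sum.cong) (auto simp: poly_monom power_minus[of i])
  \<comment> \<open>A geometric sum with ratio -i; as p is odd, (-i)^p = -i^p.\<close>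
  have s: "(i + 1) * poly s i = i ^ p - i" for i
  proof -
    have "(i + 1) * (\<Sum>k\<in>{1..<Suc n}. (-i) ^ k) = - i - (-i) ^ Suc n" for n
      by (induction n) (auto simp: algebra_simps)
    from this[of "p - 1"] have "(i + 1) * (\<Sum>k\<in>{1..<p}. (-i) ^ k) = - i - (-i) ^ p"
      using p_pos by simp
    then show ?thesis using odd by (simp add: poly_s)
  qed
  have "int p dvd coeff f k"
  proof (rule coeffs_dvd_if_roots[of _ "p - 1"])
    have "degree s \<le> p - 1"
      unfolding s_def by (rule degree_sum_le) (auto intro: order.trans[OF degree_monom_le])
    then show "degree f \<le> p - 1"
      unfolding f_def by (intro degree_diff_le) (auto simp: degree_falling_poly)
  next
    fix i assume "i \<le> p - 1"
    then consider "i < p - 1" | "i = p - 1" by linarith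
    then show "int p dvd poly f (int i)"
    proof cases
      case 1
      then have "poly (falling_poly (p - 1)) (int i) = 0"
        by (auto simp: falling_poly_def poly_prod)
      moreover have "int p dvd (int i + 1) * poly s (int i)"
        unfolding s using fermat_int by (simp add: cong_iff_dvd_diff)
      moreover have "\<not> int p dvd int i + 1"
        using 1 zdvd_not_zless[of "int i + 1" "int p"] by simp
      ultimately show ?thesis using prime_p by (simp add: f_def prime_dvd_mult_iff)
    next
      case 2
      \<comment> \<open>Here i is -1 modulo p, so s consists of p - 1 ones and is -1, as is (p - 1)!
        by Wilson.\<close>
      have "poly (falling_poly (p - 1)) (int i) = fact (p - 1)"
        by (simp add: falling_poly_def poly_prod 2 fact_prod_rev atLeast0LessThan diff_diff_eq)
      moreover have "[poly s (int i) = (\<Sum>k\<in>{1..<p}. 1 ^ k)] (mod int p)"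
        unfolding poly_s
        by (intro cong_sum cong_pow) (use 2 p_pos in \<open>simp add: cong_iff_dvd_diff of_nat_diff\<close>)
      then have "[poly s (int i) = -1] (mod int p)"
        using p_pos dvd_add[of "int p" "poly s (int i) - (int p - 1)" "int p"]
        by (simp add: cong_iff_dvd_diff of_nat_diff)
      ultimately have "[poly f (int i) = -1 - (-1)] (mod int p)"
        unfolding f_def poly_diff by (simp only: cong_diff[OF wilson_theorem[OF prime_p]])
      then show ?thesis by (simp add: cong_0_iff)
    qed
  qed (use p_pos in simp)
  moreover have "coeff s k = (-1) ^ k"
    using assms by (simp add: s_def coeff_sum if_distrib cong: if_cong)
  ultimately show ?thesis by (simp add: f_def cong_iff_dvd_diff)
qed

end

section \<open>Gregory polynomials modulo a prime\<close>

text \<open>Represents ell(y): this is y times the classical quotient (y^(p-1) - 1)/p.\<close>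

definition fermat_quot :: "nat \<Rightarrow> rat \<Rightarrow> rat" where
  "fermat_quot p y = (y ^ p - y) / of_nat p"

definition wilson_quot :: "nat \<Rightarrow> rat" where
  "wilson_quot p = (fact (p - 1) + 1) / of_nat p"

definition fwd_diff :: "(rat \<Rightarrow> rat) \<Rightarrow> rat \<Rightarrow> rat" where
  "fwd_diff f y = f (y + 1) - f y"

lemma gbinomial_eq_sum_coeff_falling_poly:
  "(y::rat) gchoose n = (\<Sum>k\<le>n. of_int (coeff (falling_poly n) k) * y ^ k) / fact n"
proof -
  have "y gchoose n = poly (gbinomial_poly n) y" by simp
  also have "\<dots> = poly (falling_poly n) y / fact n"
    by (simp add: gbinomial_poly_def)
  also have "\<dots> = (\<Sum>k\<le>n. of_int (coeff (falling_poly n) k) * y ^ k) / fact n"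
    by (simp add: poly_altdef degree_falling_poly coeff_falling_poly_of_int[where 'a = rat])
  finally show ?thesis .
qed

lemma poly_gregory_poly_altdef:
  "poly (gregory_poly n) y =
     (\<Sum>k\<le>n. of_int (coeff (falling_poly n) k) * (((y + 1) ^ Suc k - y ^ Suc k) / of_nat (Suc k)))
       / fact n"
proof -
  have "poly (gregory_poly n) y = unit_integral (falling_poly n) y / fact n"
    by (simp add: gregory_poly_eq_unit_integral gbinomial_poly_def unit_integral_smult)
  also have "unit_integral (falling_poly n) y =
     (\<Sum>k\<le>n. of_int (coeff (falling_poly n) k) * (((y + 1) ^ Suc k - y ^ Suc k) / of_nat (Suc k)))"
    unfolding unit_integral_def degree_falling_poly coeff_falling_poly_of_int[where 'a = rat] ..
  finally show ?thesis .
qed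

lemma coeff_falling_poly_0: "n > 0 \<Longrightarrow> coeff (falling_poly n :: int poly) 0 = 0"
  by (auto simp: falling_poly_def poly_prod simp flip: poly_0_coeff_0)

lemma coeff_falling_poly_lead: "coeff (falling_poly n :: int poly) n = 1"
proof -
  have "lead_coeff (falling_poly n :: int poly) = 1"
    unfolding falling_poly_def lead_coeff_prod by simp
  then show ?thesis by (simp add: degree_falling_poly)
qed

context prime_modulus
begin

lemma p_integral_divide_fact_pred: "p_integral p q \<Longrightarrow> p_integral p (q / fact (p - 1))"
  using p_pos by (intro p_integral_divide_fact) auto

lemma p_integral_fermat_quot: "p_integral p y \<Longrightarrow> p_integral p (fermat_quot p y)"
  using rat_cong_fermat unfolding rat_cong_def fermat_quot_def .

lemma p_integral_wilson_quot: "p_integral p (wilson_quot p)"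
  using rat_cong_wilson by (simp add: wilson_quot_def rat_cong_def)

lemma rat_cong_inverse_fact_pred:
  assumes "p_integral p a"
  shows "rat_cong p (a / fact (p - 1)) (- a)"
proof -
  have "rat_cong p ((a / fact (p - 1)) * (-1)) ((a / fact (p - 1)) * fact (p - 1))"
    by (intro rat_cong_mult_left rat_cong_sym[OF rat_cong_wilson] p_integral_divide_fact_pred assms)
  from rat_cong_uminus[OF this] show ?thesis by simp
qed

text \<open>The denominators n! and k + 1 for k <= n are prime to p in this range. G_(p-1) lies just
  outside: its leading term has denominator p.\<close>

lemma p_integral_gregory_poly:
  assumes "Suc n < p" "p_integral p y"
  shows "p_integral p (poly (gregory_poly n) y)"
  unfolding poly_gregory_poly_altdef using assms
  by (intro p_integral_divide_fact p_integral_sum p_integral_mult p_integral_divide_nat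
      p_integral_diff p_integral_power p_integral_add) auto

lemma rat_cong_coeff_falling_poly_pred:
  assumes "p > 2" "0 < k" "k < p"
  shows "rat_cong p (of_int (coeff (falling_poly (p - 1)) k)) ((-1) ^ k)"
  using rat_cong_of_int[OF coeff_falling_poly_pred[OF assms]] by simp

text \<open>Modulo p, the numerator is the geometric sum of (-y)^k over 0 < k < p, that is (y^p -
  y)/(y + 1), and Fermat applies because 1/(y + 1) is p-integral.\<close>

lemma rat_cong_gbinomial_pred:
  assumes "p > 2" "p_integral p y" "p_integral p (1 / (y + 1))" "y \<noteq> -1"
  shows "rat_cong p (y gchoose (p - 1)) 0"
proof -
  have odd: "odd p" using prime_p assms(1) prime_odd_nat by blast
  have sum_eq: "(y + 1) * (\<Sum>k\<in>{1..<Suc n}. (-y) ^ k) = - y - (-y) ^ Suc n" for n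
    by (induction n) (auto simp: algebra_simps)
  have "(\<Sum>k\<le>p-1. of_int (coeff (falling_poly (p - 1)) k) * y ^ k) =
      (\<Sum>k\<in>{1..<p}. of_int (coeff (falling_poly (p - 1)) k) * y ^ k)"
    using assms(1) by (intro sum.mono_neutral_right) (auto simp: coeff_falling_poly_0 not_le)
  also have "rat_cong p \<dots> (\<Sum>k\<in>{1..<p}. (-1) ^ k * y ^ k)"
    using assms by (intro rat_cong_sum rat_cong_mult_right rat_cong_coeff_falling_poly_pred
        p_integral_power) auto
  also have "(\<Sum>k\<in>{1..<p}. (-1) ^ k * y ^ k) = (1 / (y + 1)) * (y ^ p - y)"
  proof -
    have "(y + 1) * (\<Sum>k\<in>{1..<p}. (-1) ^ k * y ^ k) = y ^ p - y"
      using sum_eq[of "p - 1"] odd p_pos by (simp flip: power_mult_distrib)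
    moreover have "y + 1 \<noteq> 0" using assms(4) by (simp add: add_eq_0_iff2)
    ultimately show ?thesis by (simp add: field_simps)
  qed
  also have "rat_cong p \<dots> (1 / (y + 1) * (y - y))"
    using assms by (intro rat_cong_mult_left rat_cong_diff rat_cong_fermat) auto
  finally have "rat_cong p ((1 / fact (p - 1)) *
       (\<Sum>k\<le>p-1. of_int (coeff (falling_poly (p - 1)) k) * y ^ k)) (1 / fact (p - 1) * 0)"
    by (intro rat_cong_mult_left p_integral_divide_fact_pred) auto
  then show ?thesis by (simp add: gbinomial_eq_sum_coeff_falling_poly)
qed

text \<open>Here binom(p, k)/p = binom(p - 1, k - 1)/k, and the new binomial is (-1)^(k-1) modulo p.
  The result is the series of log(1 + z) truncated before z^p.\<close>

lemma rat_cong_power_add_one: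
  assumes "p_integral p z"
  shows "rat_cong p (((z + 1) ^ p - z ^ p - 1) / of_nat p)
           (\<Sum>k=1..p-1. (-1) ^ (k - 1) * (z ^ k / of_nat k))"
proof -
  have "(z + 1) ^ p = (\<Sum>k\<le>p. of_nat (p choose k) * z ^ k)"
    by (simp add: binomial_ring)
  also have "\<dots> = (\<Sum>k\<in>insert 0 (insert p {1..p-1}). of_nat (p choose k) * z ^ k)"
    by (intro sum.cong) auto
  also have "\<dots> = 1 + z ^ p + (\<Sum>k=1..p-1. of_nat (p choose k) * z ^ k)"
    using p_pos by (subst sum.insert, simp, simp, subst sum.insert) auto
  finally have "((z + 1) ^ p - z ^ p - 1) / of_nat p =
      (\<Sum>k=1..p-1. of_nat (p choose k) * z ^ k / of_nat p)"
    by (simp add: sum_divide_distrib)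
  also have "\<dots> = (\<Sum>k=1..p-1. of_nat ((p - 1) choose (k - 1)) * (z ^ k / of_nat k))"
  proof (rule sum.cong)
    fix k assume k: "k \<in> {1..p-1}"
    then have "k * (p choose k) = p * ((p - 1) choose (k - 1))"
      using times_binomial_minus1_eq[of k p] by simp
    then have "of_nat k * of_nat (p choose k) = (of_nat p * of_nat ((p - 1) choose (k - 1)) :: rat)"
      by (simp flip: of_nat_mult)
    then show "of_nat (p choose k) * z ^ k / of_nat p =
        of_nat ((p - 1) choose (k - 1)) * (z ^ k / of_nat k)"
      using k p_pos by (simp add: field_simps)
  qed simp
  also have "rat_cong p \<dots> (\<Sum>k=1..p-1. (-1) ^ (k - 1) * (z ^ k / of_nat k))"
    using p_pos assms by (intro rat_cong_sum rat_cong_mult_right rat_cong_choose_pred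
        p_integral_divide_nat p_integral_power) auto
  finally show ?thesis .
qed

text \<open>The leading term of the integral has denominator p and is treated exactly. The other
  terms reduce to alternating sums, which are truncated logarithms and hence p-th powers by
  \<open>rat_cong_power_add_one\<close>.\<close>

lemma rat_cong_gregory_poly_pred:
  assumes "p > 2" and y: "p_integral p y"
  shows "rat_cong p (poly (gregory_poly (p - 1)) y)
           (- fwd_diff (fermat_quot p) (y + 1) - (wilson_quot p - 1 + 1 / of_nat p))"
proof -
  define f :: rat where "f = fact (p - 1)"
  have "f \<noteq> 0" by (simp add: f_def)
  define d where "d k = ((y + 1) ^ Suc k - y ^ Suc k) / of_nat (Suc k)" for k
  define c :: "nat \<Rightarrow> rat" where "c k = of_int (coeff (falling_poly (p - 1)) k)" for k
  define S where "S z = (\<Sum>k=1..p-1. (-1) ^ (k - 1) * (z ^ k / of_nat k))" for z :: rat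
  define D where "D = ((y + 1) ^ p - y ^ p) / of_nat p"
  have "(\<Sum>k\<le>p-1. c k * d k) = (\<Sum>k\<in>insert 0 (insert (p - 1) {1..<p-1}). c k * d k)"
    by (intro sum.cong) auto
  also have "\<dots> = D + (\<Sum>k\<in>{1..<p-1}. c k * d k)"
    using assms(1) by (subst sum.insert, simp, simp, subst sum.insert)
      (auto simp: c_def d_def D_def coeff_falling_poly_0 coeff_falling_poly_lead simp flip: power_Suc)
  finally have G: "poly (gregory_poly (p - 1)) y = D / f + (\<Sum>k\<in>{1..<p-1}. c k * d k) / f"
    unfolding poly_gregory_poly_altdef f_def c_def d_def by (simp add: add_divide_distrib)

  have int_d: "p_integral p (d k)" if "k \<in> {1..<p-1}" for k
    unfolding d_def using that y
    by (intro p_integral_divide_nat p_integral_diff p_integral_power p_integral_add) auto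
  \<comment> \<open>After the index shift the sum starts at 2; the missing term k = 1 of S(y + 1) -
    S(y) is (y + 1) - y = 1.\<close>
  have sum_d: "(\<Sum>k\<in>{1..<p-1}. (-1) ^ k * d k) = S (y + 1) - S y - 1"
  proof -
    have "(\<Sum>k\<in>{1..<p-1}. (-1) ^ k * d k) =
        (\<Sum>k\<in>{2..p-1}. (-1) ^ (k - 1) * (((y + 1) ^ k - y ^ k) / of_nat k))"
      unfolding d_def
      by (rule sum.reindex_bij_witness[of _ "\<lambda>k. k - 1" Suc]) auto
    moreover have "S (y + 1) - S y = (\<Sum>k\<in>insert 1 {2..p-1}. (-1) ^ (k - 1) * (((y + 1) ^ k - y ^ k) / of_nat k))"
      unfolding S_def sum_subtractf[symmetric] right_diff_distrib[symmetric] diff_divide_distrib[symmetric]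
      using assms(1) by (intro sum.cong) auto
    ultimately show ?thesis by simp
  qed
  have "rat_cong p ((\<Sum>k\<in>{1..<p-1}. c k * d k) / f) (- (\<Sum>k\<in>{1..<p-1}. c k * d k))"
    unfolding f_def c_def
    by (intro rat_cong_inverse_fact_pred p_integral_sum p_integral_mult int_d) auto
  also have "rat_cong p \<dots> (- (\<Sum>k\<in>{1..<p-1}. (-1) ^ k * d k))"
    unfolding c_def using assms(1)
    by (intro rat_cong_uminus rat_cong_sum rat_cong_mult_right rat_cong_coeff_falling_poly_pred int_d) auto
  also have "\<dots> = 1 - (S (y + 1) - S y)" unfolding sum_d by simp
  also have "rat_cong p \<dots> (1 - (((y + 1 + 1) ^ p - (y + 1) ^ p - 1) / of_nat p
      - ((y + 1) ^ p - y ^ p - 1) / of_nat p))"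
    unfolding S_def using y
    by (intro rat_cong_diff rat_cong_refl rat_cong_sym[OF rat_cong_power_add_one] p_integral_add) auto
  finally have 1: "rat_cong p ((\<Sum>k\<in>{1..<p-1}. c k * d k) / f)
    (1 - (((y + 1 + 1) ^ p - (y + 1) ^ p - 1) / of_nat p - ((y + 1) ^ p - y ^ p - 1) / of_nat p))" .

  \<comment> \<open>D need not be p-integral, so (p - 1)! cannot simply be replaced by -1. The exact
    relation (p - 1)! = p W - 1, with W the Wilson quotient, leaves p D W / (p - 1)!, and p D is
    p-integral.\<close>
  have "D / f = - D + ((y + 1) ^ p - y ^ p) * wilson_quot p / f"
    using \<open>f \<noteq> 0\<close> p_pos unfolding D_def wilson_quot_def f_def[symmetric]
    by (simp add: divide_simps) (simp add: algebra_simps)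
  also have "rat_cong p \<dots> (- D + - (((y + 1) ^ p - y ^ p) * wilson_quot p))"
    unfolding f_def using y
    by (intro rat_cong_add rat_cong_refl rat_cong_inverse_fact_pred p_integral_mult p_integral_diff
        p_integral_power p_integral_wilson_quot p_integral_add) auto
  also have "rat_cong p \<dots> (- D + - ((y + 1 - y) * wilson_quot p))"
    using y by (intro rat_cong_add rat_cong_refl rat_cong_uminus rat_cong_mult_right rat_cong_diff
        rat_cong_fermat p_integral_wilson_quot p_integral_add) auto
  finally have 2: "rat_cong p (D / f) (- D + - ((y + 1 - y) * wilson_quot p))" .

  have "rat_cong p (poly (gregory_poly (p - 1)) y) (- D + - ((y + 1 - y) * wilson_quot p) +
    (1 - (((y + 1 + 1) ^ p - (y + 1) ^ p - 1) / of_nat p - ((y + 1) ^ p - y ^ p - 1) / of_nat p)))"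
    unfolding G by (rule rat_cong_add[OF 2 1])
  \<comment> \<open>D cancels, and the explicit 1/p compensates for the linear part of
    \<open>fermat_quot\<close>.\<close>
  also have "\<dots> = - fwd_diff (fermat_quot p) (y + 1) - (wilson_quot p - 1 + 1 / of_nat p)"
    by (simp add: D_def fwd_diff_def fermat_quot_def diff_divide_distrib add_divide_distrib)
  finally show ?thesis .
qed

text \<open>Each step lowers the index by \<open>gregory_poly_add_one\<close> and applies one more
  forward difference. The first such step removes the constant W - 1 + 1/p, which therefore occurs
  for N = 1 only.\<close>

lemma rat_cong_gregory_poly:
  assumes "p > 2" "p_integral p y" "0 < N" "N < p"
  shows "rat_cong p (poly (gregory_poly (p - N)) y)
           (- (fwd_diff ^^ N) (fermat_quot p) (y + 1)
            - (if N = 1 then wilson_quot p - 1 + 1 / of_nat p else 0))"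
  using assms(3,4,2)
proof (induction N arbitrary: y rule: nat_induct_non_zero)
  case 1
  then show ?case using rat_cong_gregory_poly_pred[OF assms(1)] by simp
next
  case (Suc N)
  have N: "p - N = Suc (p - Suc N)" using Suc.prems by simp
  have "poly (gregory_poly (p - Suc N)) y =
      poly (gregory_poly (p - N)) (y + 1) - poly (gregory_poly (p - N)) y"
    unfolding N gregory_poly_add_one by simp
  also have "rat_cong p \<dots>
      ((- (fwd_diff ^^ N) (fermat_quot p) (y + 1 + 1)
            - (if N = 1 then wilson_quot p - 1 + 1 / of_nat p else 0)) -
       (- (fwd_diff ^^ N) (fermat_quot p) (y + 1)
            - (if N = 1 then wilson_quot p - 1 + 1 / of_nat p else 0)))"
    using Suc.prems by (intro rat_cong_diff Suc.IH p_integral_add) auto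
  also have "\<dots> = - (fwd_diff ^^ Suc N) (fermat_quot p) (y + 1)
      - (if Suc N = 1 then wilson_quot p - 1 + 1 / of_nat p else 0)"
    using Suc.hyps by (simp add: fwd_diff_def)
  finally show ?case .
qed

end

section \<open>The coefficients of \<open>(1 + t)\<^sup>m log (1 + t)\<close>\<close>

definition ln_coeff :: "nat \<Rightarrow> nat \<Rightarrow> rat" where
  "ln_coeff m N = ((1 + fps_X) ^ m * fps_ln 1) $ N"

lemma ln_coeff_0_left: "ln_coeff 0 N = (if N = 0 then 0 else (-1) ^ (N - 1) / of_nat N)"
  by (simp add: ln_coeff_def fps_ln_nth)

lemma ln_coeff_0_right [simp]: "ln_coeff m 0 = 0"
  by (simp add: ln_coeff_def)

lemma ln_coeff_Suc: "ln_coeff (Suc m) (Suc N) = ln_coeff m (Suc N) + ln_coeff m N"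
  by (simp add: ln_coeff_def distrib_right mult.assoc)

lemma ln_coeff_1: "ln_coeff m 1 = 1"
  by (induction m) (simp_all add: ln_coeff_Suc, simp add: ln_coeff_0_left)

text \<open>Induction on m by 1/(a)_(m+1) - 1/(a+1)_(m+1) = (m+1)/(a)_(m+2) with a = k + 1. P is the
  common factor of the two products.\<close>

lemma ln_coeff_closed:
  "ln_coeff m (m + 1 + k) = (-1) ^ k * fact m / pochhammer (of_nat (k + 1)) (m + 1)"
proof (induction m arbitrary: k)
  case 0
  then show ?case by (simp add: ln_coeff_0_left)
next
  case (Suc m)
  define P where "P = pochhammer (of_nat (k + 2) :: rat) m"
  have "P > 0" unfolding P_def by (rule pochhammer_pos) simp
  have 1: "pochhammer (of_nat (k + 1) :: rat) (m + 1) = of_nat (k + 1) * P"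
    using pochhammer_rec[of "of_nat (k + 1) :: rat" m] by (simp add: P_def)
  have 2: "pochhammer (of_nat (k + 1 + 1) :: rat) (m + 1) = P * of_nat (k + m + 2)"
    by (simp add: P_def pochhammer_Suc add_ac)
  have 3: "pochhammer (of_nat (k + 1) :: rat) (Suc m + 1) = of_nat (k + 1) * P * of_nat (k + m + 2)"
  proof -
    have "pochhammer (of_nat (k + 1) :: rat) (Suc m + 1) =
        pochhammer (of_nat (k + 1)) (m + 1) * of_nat (k + m + 2)"
      unfolding Suc_eq_plus1[symmetric] pochhammer_Suc[of _ "Suc m"] by (simp add: add_ac)
    then show ?thesis by (simp only: 1)
  qed
  have "ln_coeff (Suc m) (Suc m + 1 + k) = ln_coeff m (m + 1 + (k + 1)) + ln_coeff m (m + 1 + k)"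
    using ln_coeff_Suc[of m "m + 1 + k"] by simp
  also have "\<dots> = (-1) ^ k * fact (Suc m) / (of_nat (k + 1) * P * of_nat (k + m + 2))"
    unfolding Suc.IH 1 2 using \<open>P > 0\<close>
    by (simp add: divide_simps del: of_nat_add of_nat_Suc) (simp add: algebra_simps)
  finally show ?case unfolding 3 .
qed

text \<open>The factor log(1 + t) cancels against the denominator of the generating function,
  leaving t (1 + t)^(x+m).\<close>

lemma sum_ln_coeff_gregory:
  "(\<Sum>N=1..n. ln_coeff m N * poly (gregory_poly (n - N)) x) =
     (if n = 0 then 0 else (x + of_nat m) gchoose (n - 1))"
proof -
  let ?F = "Abs_fps (\<lambda>n. poly (gregory_poly n) x)"
  have "((1 + fps_X) ^ m * fps_ln 1) * ?F = fps_X * (fps_binomial x * fps_binomial (of_nat m))"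
    using gregory_gf_mult_ln[of x] by (simp add: fps_binomial_of_nat mult_ac)
  then have "(((1 + fps_X) ^ m * fps_ln 1) * ?F) $ n = (fps_X * fps_binomial (x + of_nat m)) $ n"
    by (simp add: fps_binomial_add_mult)
  moreover have "(((1 + fps_X) ^ m * fps_ln 1) * ?F) $ n =
      (\<Sum>N=0..n. ln_coeff m N * poly (gregory_poly (n - N)) x)"
    by (simp add: fps_mult_nth[of "(1 + fps_X) ^ m * fps_ln 1"] ln_coeff_def)
  moreover have "\<dots> = (\<Sum>N=1..n. ln_coeff m N * poly (gregory_poly (n - N)) x)"
    by (intro sum.mono_neutral_right) (auto simp: Suc_le_eq)
  ultimately show ?thesis by simp
qed

lemma Harm_Suc: "Harm (Suc m) = Harm m + 1 / of_nat (Suc m)"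
  by (simp add: Harm_def)

lemma fwd_diff_funpow:
  "(fwd_diff ^^ n) f y = (\<Sum>i\<le>n. (-1) ^ (n - i) * of_nat (n choose i) * f (y + of_nat i))"
proof (induction n arbitrary: y)
  case (Suc n)
  have "(\<Sum>i\<le>n. (-1) ^ (n - i) * of_nat (n choose i) * f (y + of_nat i)) =
      - (\<Sum>i\<le>Suc n. (-1) ^ (Suc n - i) * of_nat (n choose i) * f (y + of_nat i))"
    by (simp add: sum_negf[symmetric] Suc_diff_le)
  also have "\<dots> = - ((-1) ^ Suc n * f y +
      (\<Sum>i\<le>n. (-1) ^ (n - i) * of_nat (n choose Suc i) * f (y + 1 + of_nat i)))"
    by (subst sum.atMost_Suc_shift) (simp add: add_ac)
  finally have "(fwd_diff ^^ Suc n) f y = (-1) ^ Suc n * f y +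
      (\<Sum>i\<le>n. (-1) ^ (n - i) * of_nat (Suc n choose Suc i) * f (y + 1 + of_nat i))"
    by (simp add: fwd_diff_def Suc.IH algebra_simps sum.distrib)
  also have "\<dots> = (\<Sum>i\<le>Suc n. (-1) ^ (Suc n - i) * of_nat (Suc n choose i) * f (y + of_nat i))"
    by (subst sum.atMost_Suc_shift) (simp add: add_ac)
  finally show ?case .
qed simp

text \<open>Formally, this replaces \<open>(1 + t)\<^sup>m log (1 + t)\<close>, truncated after \<open>t\<^sup>m\<close>, by its expansion in powers
  of the shift operator \<open>1 + t\<close>.\<close>

lemma sum_ln_coeff_fwd_diff:
  "(\<Sum>N=1..m. ln_coeff m N * (fwd_diff ^^ N) f y) =
     Harm m * f (y + of_nat m) +
     (\<Sum>j<m. (-1) ^ (m - j) * of_nat (m choose j) / of_nat (m - j) * f (y + of_nat j))"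
proof (induction m arbitrary: y)
  case 0
  then show ?case by (simp add: Harm_def)
next
  case (Suc m)
  let ?D = "\<lambda>N. (fwd_diff ^^ N) f y"
  let ?c = "\<lambda>m j. (-1) ^ (m - j) * of_nat (m choose j) / of_nat (m - j) :: rat"
  have sh: "(\<Sum>N=1..k. g N) = (\<Sum>N<k. g (Suc N))" for g :: "nat \<Rightarrow> rat" and k
    by (rule sum.reindex_bij_witness[of _ Suc "\<lambda>k. k - 1"]) auto
  \<comment> \<open>Merges coefficients below, with s the sign, c = binom(m, j), X = binom(m+1,
    j+1), Y = binom(m, j+1), a = m + 1 and b = m - j.\<close>
  have split: "s * c / b + s * X / a = s * X / b" if "X / a = Y / b" "X = c + Y" for s c b X a Y :: rat
    using that by (metis add_divide_distrib distrib_left times_divide_eq_right)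
  have lead: "ln_coeff m (Suc m) = 1 / of_nat (Suc m)"
    using ln_coeff_closed[of m 0] by (simp add: pochhammer_fact[symmetric])
  have "(\<Sum>N=1..Suc m. ln_coeff (Suc m) N * ?D N) =
      (\<Sum>N<Suc m. ln_coeff m (Suc N) * ?D (Suc N)) + (\<Sum>N<Suc m. ln_coeff m N * ?D (Suc N))"
    unfolding sh ln_coeff_Suc distrib_right sum.distrib ..
  also have "(\<Sum>N<Suc m. ln_coeff m (Suc N) * ?D (Suc N)) =
      (\<Sum>N=1..m. ln_coeff m N * ?D N) + ?D (Suc m) / of_nat (Suc m)"
    unfolding sh by (simp add: lead)
  also have "(\<Sum>N<Suc m. ln_coeff m N * ?D (Suc N)) = (\<Sum>N=1..m. ln_coeff m N * ?D (Suc N))"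
    unfolding sh by (subst sum.lessThan_Suc_shift) simp
  \<comment> \<open>The N-th and (N+1)-st differences at y add up to the N-th difference at y + 1,
    where the induction hypothesis applies.\<close>
  also have "(\<Sum>N=1..m. ln_coeff m N * ?D N) + ?D (Suc m) / of_nat (Suc m) +
      (\<Sum>N=1..m. ln_coeff m N * ?D (Suc N)) =
      (\<Sum>N=1..m. ln_coeff m N * (fwd_diff ^^ N) f (y + 1)) + ?D (Suc m) / of_nat (Suc m)"
    by (simp add: fwd_diff_def algebra_simps sum_subtractf)
  also have "?D (Suc m) / of_nat (Suc m) =
      (\<Sum>j\<le>Suc m. (-1) ^ (Suc m - j) * of_nat (Suc m choose j) / of_nat (Suc m) * f (y + of_nat j))"
    unfolding fwd_diff_funpow sum_divide_distrib by (rule sum.cong) auto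
  \<comment> \<open>The last term will raise H_m to H_(m+1), the term in f(y) is the new summand j =
    0, and the rest merges with the induction hypothesis.\<close>
  also have "\<dots> = f (y + of_nat (Suc m)) / of_nat (Suc m) + (-1) ^ Suc m / of_nat (Suc m) * f y +
      (\<Sum>j<m. (-1) ^ (m - j) * of_nat (Suc m choose Suc j) / of_nat (Suc m) * f (y + of_nat (Suc j)))"
    unfolding lessThan_Suc_atMost[symmetric]
    by (subst sum.lessThan_Suc, subst sum.lessThan_Suc_shift)
       (simp del: of_nat_Suc power_Suc binomial_Suc_Suc)
  also have "(\<Sum>N=1..m. ln_coeff m N * (fwd_diff ^^ N) f (y + 1)) =
      Harm m * f (y + of_nat (Suc m)) + (\<Sum>j<m. ?c m j * f (y + of_nat (Suc j)))"
    unfolding Suc.IH by (simp add: add_ac)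
  also have "Harm m * f (y + of_nat (Suc m)) + (\<Sum>j<m. ?c m j * f (y + of_nat (Suc j))) +
     (f (y + of_nat (Suc m)) / of_nat (Suc m) + (-1) ^ Suc m / of_nat (Suc m) * f y +
      (\<Sum>j<m. (-1) ^ (m - j) * of_nat (Suc m choose Suc j) / of_nat (Suc m) * f (y + of_nat (Suc j))))
     = Harm (Suc m) * f (y + of_nat (Suc m)) + ((-1) ^ Suc m / of_nat (Suc m) * f y +
        (\<Sum>j<m. (?c m j + (-1) ^ (m - j) * of_nat (Suc m choose Suc j) / of_nat (Suc m)) * f (y + of_nat (Suc j))))"
    by (simp only: Harm_Suc distrib_right sum.distrib) simp
  also have "(\<Sum>j<m. (?c m j + (-1) ^ (m - j) * of_nat (Suc m choose Suc j) / of_nat (Suc m)) * f (y + of_nat (Suc j)))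
     = (\<Sum>j<m. ?c (Suc m) (Suc j) * f (y + of_nat (Suc j)))"
  proof (rule sum.cong)
    fix j assume "j \<in> {..<m}"
    then have j: "j < m" by simp
    have "(Suc m - Suc j) * (Suc m choose Suc j) = Suc m * (m choose Suc j)"
      using binomial_absorb_comp[of "Suc m" "Suc j"] by simp
    then have "of_nat (m - j) * of_nat (Suc m choose Suc j) = (of_nat (Suc m) * of_nat (m choose Suc j) :: rat)"
      by (simp only: diff_Suc_Suc flip: of_nat_mult)
    then have "of_nat (Suc m choose Suc j) / of_nat (Suc m) = (of_nat (m choose Suc j) / of_nat (m - j) :: rat)"
      using j by (simp add: divide_simps mult_ac del: of_nat_Suc binomial_Suc_Suc)
    moreover have "of_nat (Suc m choose Suc j) = (of_nat (m choose j) + of_nat (m choose Suc j) :: rat)"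
      by simp
    ultimately have "?c m j + (-1) ^ (m - j) * of_nat (Suc m choose Suc j) / of_nat (Suc m) = ?c (Suc m) (Suc j)"
      unfolding diff_Suc_Suc by (rule split)
    then show "(?c m j + (-1) ^ (m - j) * of_nat (Suc m choose Suc j) / of_nat (Suc m)) * f (y + of_nat (Suc j))
       = ?c (Suc m) (Suc j) * f (y + of_nat (Suc j))" by (simp only:)
  qed simp
  also have "(-1) ^ Suc m / of_nat (Suc m) * f y + (\<Sum>j<m. ?c (Suc m) (Suc j) * f (y + of_nat (Suc j))) =
      (\<Sum>j<Suc m. ?c (Suc m) j * f (y + of_nat j))"
    by (subst sum.lessThan_Suc_shift) (simp del: of_nat_Suc power_Suc binomial_Suc_Suc)
  finally show ?case .
qed

section \<open>The coefficients e_N modulo p and the sum in gamma^K\<close>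

context prime_modulus
begin

lemma p_integral_ln_coeff: "N < p \<Longrightarrow> p_integral p (ln_coeff m N)"
proof (induction m arbitrary: N)
  case 0
  then show ?case
    by (auto simp: ln_coeff_0_left intro!: p_integral_divide_nat p_integral_power p_integral_uminus)
next
  case (Suc m)
  then show ?case by (cases N) (auto simp: ln_coeff_Suc intro!: p_integral_add)
qed

lemma rat_cong_pochhammer:
  assumes "rat_cong p a b" "p_integral p b"
  shows "rat_cong p (pochhammer a k) (pochhammer b k)"
proof -
  note a = rat_cong_p_integral[OF assms]
  have int: "p_integral p (pochhammer b k)" for k
    by (induction k) (auto simp: pochhammer_Suc intro!: p_integral_mult p_integral_add assms)
  show ?thesis
    by (induction k)
       (auto simp: pochhammer_Suc intro!: rat_cong_mult rat_cong_add p_integral_add assms a int)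
qed

lemma p_integral_inverse_pochhammer:
  assumes "0 < n" "n + k \<le> p"
  shows "p_integral p (1 / pochhammer (of_nat n) k)"
  using p_integral_divide_nat_prod[OF p_integral_1, of "{0..<k}" "\<lambda>i. n + i"] assms
  by (simp add: pochhammer_prod)

text \<open>The closed form has the factors p - n - m, ..., p - n in its denominator. Modulo p these
  are -(n + m), ..., -n, so reversing them gives (n)_(m+1) up to the sign (-1)^(m+1).\<close>

lemma rat_cong_ln_coeff_reflect:
  assumes "p > 2" "0 < n" "n + m < p"
  shows "rat_cong p (ln_coeff m (p - n)) ((-1) ^ (n - 1) * fact m / pochhammer (of_nat n) (m + 1))"
proof -
  have odd: "odd p" using prime_p assms(1) prime_odd_nat by blast
  define k where "k = p - n - m - 1"
  have k: "p - n = m + 1 + k" "p = n + m + 1 + k" using assms by (auto simp: k_def)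
  have bound: "k + 1 + (m + 1) \<le> p" using k(2) assms(2) by linarith
  have "rat_cong p (of_nat n - of_nat p) (of_nat n)"
    using p_pos p_integral_of_int[of "-1"] by (simp add: rat_cong_def)
  from rat_cong_pochhammer[OF this, of "m + 1"]
  have 1: "rat_cong p (pochhammer (of_nat n - of_nat p) (m + 1)) (pochhammer (of_nat n) (m + 1))"
    by simp
  have "pochhammer (- (of_nat p - of_nat n)) (m + 1) =
      (-1) ^ (m + 1) * pochhammer (of_nat p - of_nat n - of_nat (m + 1) + 1 :: rat) (m + 1)"
    by (rule pochhammer_minus)
  also have "of_nat p - of_nat n - of_nat (m + 1) + 1 = (of_nat (k + 1) :: rat)"
    by (simp add: k(2))
  finally have 2: "pochhammer (of_nat n - of_nat p :: rat) (m + 1) =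
      (-1) ^ (m + 1) * pochhammer (of_nat (k + 1)) (m + 1)" by simp
  have pos: "pochhammer (of_nat (k + 1) :: rat) (m + 1) > 0" "pochhammer (of_nat n :: rat) (m + 1) > 0"
    using assms by (intro pochhammer_pos; simp)+
  have "rat_cong p (1 / pochhammer (of_nat n - of_nat p) (m + 1)) (1 / pochhammer (of_nat n) (m + 1))"
  proof (rule rat_cong_divide_swap[OF 1])
    have "p_integral p ((-1) ^ (m + 1) * (1 / pochhammer (of_nat (k + 1)) (m + 1)))"
      by (intro p_integral_mult p_integral_power p_integral_uminus
          p_integral_inverse_pochhammer[OF _ bound]) simp_all
    also have "(-1) ^ (m + 1) * (1 / pochhammer (of_nat (k + 1)) (m + 1)) =
        (1 / pochhammer (of_nat n - of_nat p) (m + 1) :: rat)"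
      unfolding 2 by (cases "even m") auto
    finally show "p_integral p (1 / pochhammer (of_nat n - of_nat p) (m + 1))" .
  next
    show "p_integral p (1 / pochhammer (of_nat n) (m + 1))"
      by (rule p_integral_inverse_pochhammer) (use assms in auto)
  next
    show "pochhammer (of_nat n - of_nat p :: rat) (m + 1) \<noteq> 0"
      unfolding 2 using pos(1) by simp
  qed (use pos(2) in simp)
  moreover have "p_integral p ((-1) ^ (n - 1) * fact m)"
    using p_integral_of_nat[of "fact m"]
    by (auto intro!: p_integral_mult p_integral_power p_integral_uminus)
  ultimately have "rat_cong p ((-1) ^ (n - 1) * fact m * (1 / pochhammer (of_nat n - of_nat p) (m + 1)))
      ((-1) ^ (n - 1) * fact m * (1 / pochhammer (of_nat n) (m + 1)))"
    by (rule rat_cong_mult_left)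
  moreover have "ln_coeff m (p - n) =
      (-1) ^ (n - 1) * fact m * (1 / pochhammer (of_nat n - of_nat p) (m + 1))"
  proof -
    \<comment> \<open>As p is odd, k + m + 1 = p - n has the parity of n - 1.\<close>
    have "(-1 :: rat) ^ k = (-1) ^ (n - 1) * (-1) ^ (m + 1)"
      using odd assms(2) unfolding k(2) by (cases n) (auto simp: minus_one_power_iff)
    then show ?thesis
      unfolding k(1) ln_coeff_closed 2 by (cases "even m") auto
  qed
  ultimately show ?thesis by simp
qed

text \<open>Passing from m to m + 1 adds e_(p-1), which is m!/(m+1)! = 1/(m+1) modulo p by the
  reflection with n = 1. The start is (-1)^(p-1)/p = 1/p.\<close>

lemma rat_cong_ln_coeff_p:
  assumes "p > 2" "m < p"
  shows "rat_cong p (ln_coeff m p) (1 / of_nat p + Harm m)"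
  using assms(2)
proof (induction m)
  case 0
  have "odd p" using prime_p assms(1) prime_odd_nat by blast
  then show ?case using p_pos by (simp add: ln_coeff_0_left Harm_def)
next
  case (Suc m)
  have "ln_coeff (Suc m) p = ln_coeff m p + ln_coeff m (p - 1)"
    using ln_coeff_Suc[of m "p - 1"] p_pos by simp
  also have "rat_cong p \<dots> (1 / of_nat p + Harm m + (-1) ^ (1 - 1) * fact m / pochhammer (of_nat 1) (m + 1))"
    by (intro rat_cong_add Suc.IH rat_cong_ln_coeff_reflect) (use assms Suc.prems in auto)
  also have "pochhammer (of_nat 1 :: rat) (m + 1) = fact (m + 1)"
    by (simp add: pochhammer_fact)
  also have "1 / of_nat p + Harm m + (-1) ^ (1 - 1) * fact m / fact (m + 1) = 1 / of_nat p + Harm (Suc m)"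
    by (simp add: Harm_Suc del: of_nat_Suc)
  finally show ?case .
qed

text \<open>The ranges N <= m (A), m < N < p (B) and N = p of the exact identity are reduced
  separately. A and e_p are not p-integral, but their parts -1/p and 1/p cancel.\<close>

lemma rat_cong_gregory_sum:
  assumes "p > 2" "0 < m" "m < p" "p_integral p x"
  shows "rat_cong p
    (fact m * (\<Sum>n=1..p-m-1. (-1) ^ (n - 1) * poly (gregory_poly n) x / pochhammer (of_nat n) (m + 1)))
    (((x + of_nat m) gchoose (p - 1)) - Harm m + wilson_quot p - 1
      + Harm m * fermat_quot p (x + of_nat m + 1)
      + (\<Sum>j<m. (-1) ^ (m - j) * of_nat (m choose j) / of_nat (m - j) * fermat_quot p (x + of_nat j + 1)))"
proof -
  let ?G = "\<lambda>n. poly (gregory_poly n) x"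
  let ?w = "wilson_quot p - 1 + 1 / of_nat p"
  define A where "A = (\<Sum>N=1..m. ln_coeff m N * ?G (p - N))"
  define B where "B = (\<Sum>N=m+1..p-1. ln_coeff m N * ?G (p - N))"
  have "?G 0 = 1"
    by (simp add: gregory_poly_eq_unit_integral gbinomial_poly_def falling_poly_def unit_integral_def)
  moreover have "{1..p} = insert p ({1..m} \<union> {m+1..p-1})" using assms by auto
  ultimately have "(\<Sum>N=1..p. ln_coeff m N * ?G (p - N)) = ln_coeff m p + (A + B)"
    unfolding A_def B_def using assms(3) by (subst sum.union_disjoint[symmetric]) auto
  then have eq: "B = ((x + of_nat m) gchoose (p - 1)) - A - ln_coeff m p"
    unfolding sum_ln_coeff_gregory using p_pos by simp

  have "B = (\<Sum>n=1..p-m-1. ln_coeff m (p - n) * ?G n)"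
    unfolding B_def by (rule sum.reindex_bij_witness[of _ "\<lambda>n. p - n" "\<lambda>n. p - n"]) (use assms in auto)
  also have "rat_cong p \<dots> (\<Sum>n=1..p-m-1. (-1) ^ (n - 1) * fact m / pochhammer (of_nat n) (m + 1) * ?G n)"
    using assms by (intro rat_cong_sum rat_cong_mult_right rat_cong_ln_coeff_reflect p_integral_gregory_poly) auto
  also have "\<dots> = fact m * (\<Sum>n=1..p-m-1. (-1) ^ (n - 1) * ?G n / pochhammer (of_nat n) (m + 1))"
    by (simp add: sum_distrib_left mult_ac)
  finally have B: "rat_cong p B \<dots>" .

  have "rat_cong p A (\<Sum>N=1..m. ln_coeff m N * (- (fwd_diff ^^ N) (fermat_quot p) (x + 1)
            - (if N = 1 then ?w else 0)))"
    unfolding A_def using assms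
    by (intro rat_cong_sum rat_cong_mult_left rat_cong_gregory_poly p_integral_ln_coeff) auto
  also have "\<dots> = - (\<Sum>N=1..m. ln_coeff m N * (fwd_diff ^^ N) (fermat_quot p) (x + 1))
      - (\<Sum>N=1..m. if N = 1 then ln_coeff m N * ?w else 0)"
    by (simp add: sum_negf sum_subtractf right_diff_distrib if_distrib[of "(*) _"] cong: if_cong)
  also have "(\<Sum>N=1..m. if N = 1 then ln_coeff m N * ?w else 0) = ?w"
    using assms(2) ln_coeff_1[of m] by (subst sum.delta) auto
  finally have A: "rat_cong p A (- (\<Sum>N=1..m. ln_coeff m N * (fwd_diff ^^ N) (fermat_quot p) (x + 1)) - ?w)" .

  have "rat_cong p (fact m * (\<Sum>n=1..p-m-1. (-1) ^ (n - 1) * ?G n / pochhammer (of_nat n) (m + 1))) B"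
    by (rule rat_cong_sym[OF B])
  also note eq
  also have "rat_cong p (((x + of_nat m) gchoose (p - 1)) - A - ln_coeff m p)
     (((x + of_nat m) gchoose (p - 1))
       - (- (\<Sum>N=1..m. ln_coeff m N * (fwd_diff ^^ N) (fermat_quot p) (x + 1)) - ?w)
       - (1 / of_nat p + Harm m))"
    by (intro rat_cong_diff rat_cong_refl A rat_cong_ln_coeff_p assms)
  finally show ?thesis
    unfolding sum_ln_coeff_fwd_diff by (simp add: algebra_simps)
qed

end

section \<open>Families of rationals\<close>

text \<open>Finitely many primes do not matter in the ring, so integrality for all large primes
  suffices to avoid the default value of \<open>rat_mod\<close>.\<close>

definition ev_integral :: "(nat \<Rightarrow> rat) \<Rightarrow> bool" where
  "ev_integral f \<longleftrightarrow> (\<forall>\<^sub>F p in sequentially. prime p \<longrightarrow> p_integral p (f p))"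

lemma A_of_family_eq_eventually:
  assumes "\<forall>\<^sub>F p in sequentially. prime p \<longrightarrow> [f p = g p] (mod int p)"
  shows "A_of_family f = A_of_family g"
proof -
  have "A_rel f g"
    using assms by (simp add: A_rel_def eventually_cofinite flip: cofinite_eq_sequentially)
  then show ?thesis by transfer
qed

lemma A_mod_cong:
  assumes "ev_integral g" "\<forall>\<^sub>F p in sequentially. prime p \<longrightarrow> rat_cong p (f p) (g p)"
  shows "A_mod f = A_mod g"
  unfolding A_mod_def
proof (rule A_of_family_eq_eventually)
  show "\<forall>\<^sub>F p in sequentially. prime p \<longrightarrow> [rat_mod p (f p) = rat_mod p (g p)] (mod int p)"
    using assms unfolding ev_integral_def
  proof eventually_elim
    case (elim p)
    show ?case
    proof
      assume "prime p"
      then interpret prime_modulus p by unfold_locales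
      have g: "p_integral p (g p)" and fg: "rat_cong p (f p) (g p)"
        using elim \<open>prime p\<close> by auto
      have "rat_cong p (of_int (rat_mod p (f p))) (f p)"
        by (rule rat_cong_rat_mod[OF rat_cong_p_integral[OF fg g]])
      also note fg
      also have "rat_cong p (g p) (of_int (rat_mod p (g p)))"
        by (rule rat_cong_sym[OF rat_cong_rat_mod[OF g]])
      finally show "[rat_mod p (f p) = rat_mod p (g p)] (mod int p)"
        by (rule cong_of_rat_cong)
    qed
  qed
qed

text \<open>The common core of \<open>A_mod_add\<close> and \<open>A_mod_mult\<close>: at primes
  where both families are integral, \<open>rat_mod\<close> respects the operations up to
  congruence.\<close>

lemma A_mod_eq_A_of_family:
  assumes "ev_integral f" "ev_integral g"
    and "\<And>p. prime p \<Longrightarrow> p_integral p (f p) \<Longrightarrow> p_integral p (g p) \<Longrightarrow>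
      p_integral p (k p) \<and> rat_cong p (of_int (h p)) (k p)"
  shows "A_mod k = A_of_family h"
  unfolding A_mod_def
proof (rule A_of_family_eq_eventually)
  show "\<forall>\<^sub>F p in sequentially. prime p \<longrightarrow> [rat_mod p (k p) = h p] (mod int p)"
    using assms(1,2) unfolding ev_integral_def
  proof eventually_elim
    case (elim p)
    show ?case
    proof
      assume p: "prime p"
      then interpret prime_modulus p by unfold_locales
      have "rat_cong p (of_int (rat_mod p (k p))) (of_int (h p))"
        using assms(3)[OF p] elim p rat_cong_rat_mod[of "k p"] rat_cong_sym rat_cong_trans by blast
      then show "[rat_mod p (k p) = h p] (mod int p)" by (rule cong_of_rat_cong)
    qed
  qed
qed

lemma ev_integral_combine:
  assumes "ev_integral f" "ev_integral g"
    and "\<And>p. prime p \<Longrightarrow> p_integral p (f p) \<Longrightarrow> p_integral p (g p) \<Longrightarrow> p_integral p (h p)"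
  shows "ev_integral h"
  using assms(1,2) unfolding ev_integral_def by eventually_elim (use assms(3) in blast)

lemma ev_integral_add: "ev_integral f \<Longrightarrow> ev_integral g \<Longrightarrow> ev_integral (\<lambda>p. f p + g p)"
  by (erule (1) ev_integral_combine)
     (simp add: prime_modulus.p_integral_add prime_modulus_def)

lemma ev_integral_diff: "ev_integral f \<Longrightarrow> ev_integral g \<Longrightarrow> ev_integral (\<lambda>p. f p - g p)"
  by (erule (1) ev_integral_combine)
     (simp add: prime_modulus.p_integral_diff prime_modulus_def)

lemma ev_integral_mult: "ev_integral f \<Longrightarrow> ev_integral g \<Longrightarrow> ev_integral (\<lambda>p. f p * g p)"
  by (erule (1) ev_integral_combine)
     (simp add: prime_modulus.p_integral_mult prime_modulus_def)

lemma ev_integral_const: "ev_integral (\<lambda>_. c)"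
proof -
  obtain a b where ab: "quotient_of c = (a, b)" by force
  have "\<forall>\<^sub>F p in sequentially. nat b < p" by (rule eventually_gt_at_top)
  then show ?thesis unfolding ev_integral_def
  proof eventually_elim
    case (elim p)
    then have "\<not> int p dvd b"
      using quotient_of_denom_pos[OF ab] by (intro zdvd_not_zless) auto
    then show ?case using quotient_of_div[OF ab] unfolding p_integral_def by blast
  qed
qed

lemma ev_integral_sum: "(\<And>i. i \<in> A \<Longrightarrow> ev_integral (f i)) \<Longrightarrow> ev_integral (\<lambda>p. \<Sum>i\<in>A. f i p)"
  by (induction A rule: infinite_finite_induct) (auto intro: ev_integral_add ev_integral_const)

lemma ev_integral_fermat_quot: "ev_integral (\<lambda>p. fermat_quot p y)"
  using ev_integral_const[of y] ev_integral_const[of y]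
  by (rule ev_integral_combine) (simp add: prime_modulus.p_integral_fermat_quot prime_modulus_def)

lemma ev_integral_wilson_quot: "ev_integral wilson_quot"
  using ev_integral_const[of 0] ev_integral_const[of 0]
  by (rule ev_integral_combine) (simp add: prime_modulus.p_integral_wilson_quot prime_modulus_def)

lemmas ev_integral_intros = ev_integral_add ev_integral_diff ev_integral_mult ev_integral_const
  ev_integral_sum ev_integral_fermat_quot ev_integral_wilson_quot

lemma A_mod_add:
  assumes "ev_integral f" "ev_integral g"
  shows "A_mod (\<lambda>p. f p + g p) = A_mod f + A_mod g"
proof -
  have "A_mod (\<lambda>p. f p + g p) = A_of_family (\<lambda>p. rat_mod p (f p) + rat_mod p (g p))"
  proof (rule A_mod_eq_A_of_family[OF assms])
    fix p assume "prime p" and fg: "p_integral p (f p)" "p_integral p (g p)"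
    then interpret prime_modulus p by unfold_locales
    show "p_integral p (f p + g p) \<and>
        rat_cong p (of_int (rat_mod p (f p) + rat_mod p (g p))) (f p + g p)"
      using fg by (auto intro!: p_integral_add rat_cong_add rat_cong_rat_mod)
  qed
  then show ?thesis by (simp add: A_mod_def A_of_family_add)
qed

lemma A_mod_mult:
  assumes "ev_integral f" "ev_integral g"
  shows "A_mod (\<lambda>p. f p * g p) = A_mod f * A_mod g"
proof -
  have "A_mod (\<lambda>p. f p * g p) = A_of_family (\<lambda>p. rat_mod p (f p) * rat_mod p (g p))"
  proof (rule A_mod_eq_A_of_family[OF assms])
    fix p assume "prime p" and fg: "p_integral p (f p)" "p_integral p (g p)"
    then interpret prime_modulus p by unfold_locales
    show "p_integral p (f p * g p) \<and>
        rat_cong p (of_int (rat_mod p (f p) * rat_mod p (g p))) (f p * g p)"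
      using fg by (auto intro!: p_integral_mult rat_cong_mult rat_cong_rat_mod)
  qed
  then show ?thesis by (simp add: A_mod_def A_of_family_mult)
qed

lemma A_mod_diff:
  assumes "ev_integral f" "ev_integral g"
  shows "A_mod (\<lambda>p. f p - g p) = A_mod f - A_mod g"
  using A_mod_add[OF ev_integral_diff[OF assms] assms(2)] by simp

lemma A_mod_const: "A_mod (\<lambda>_. c) = A_of_rat c"
  by (simp add: A_of_rat_def)

lemma A_mod_sum:
  assumes "\<And>i. i \<in> A \<Longrightarrow> ev_integral (f i)"
  shows "A_mod (\<lambda>p. \<Sum>i\<in>A. f i p) = (\<Sum>i\<in>A. A_mod (f i))"
  using assms
  by (induction A rule: infinite_finite_induct)
     (simp_all add: A_mod_add ev_integral_sum A_mod_const)

lemma A_of_rat_diff: "A_of_rat (x - y) = A_of_rat x - A_of_rat y"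
  using A_of_rat_add[of "x - y" y] by simp

lemma ell_A_altdef: "ell_A x = A_mod (\<lambda>p. fermat_quot p x)"
  by (simp add: ell_A_def fermat_quot_def)

lemma gamma_W_altdef: "gamma_W = A_mod wilson_quot"
  unfolding gamma_W_def wilson_quot_def ..

text \<open>The source of the indicator. If y is not -1, then y and 1/(y + 1) are p-integral for
  almost all p and the binomial vanishes; binom(-1, p - 1) = (-1)^(p-1) = 1 for odd p.\<close>

lemma eventually_gbinomial_pred:
  "\<forall>\<^sub>F p in sequentially. prime p \<longrightarrow> rat_cong p (y gchoose (p - 1)) (indicator {-1} y)"
proof -
  have "\<forall>\<^sub>F p::nat in sequentially. 2 < p" by (rule eventually_gt_at_top)
  moreover have "\<forall>\<^sub>F p in sequentially. prime p \<longrightarrow> p_integral p y"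
    "\<forall>\<^sub>F p in sequentially. prime p \<longrightarrow> p_integral p (1 / (y + 1))"
    using ev_integral_const unfolding ev_integral_def by blast+
  ultimately show ?thesis
  proof eventually_elim
    case (elim p)
    show ?case
    proof
      assume p: "prime p"
      then interpret prime_modulus p by unfold_locales
      show "rat_cong p (y gchoose (p - 1)) (indicator {-1} y)"
      proof (cases "y = -1")
        case True
        have "odd p" using p elim(1) prime_odd_nat by blast
        then show ?thesis using True elim(1) gbinomial_minus[of "1::rat" "p - 1"]
            binomial_gbinomial[of "p - 1" "p - 1", where 'a = rat]
          by (simp add: of_nat_diff)
      next
        case False
        then show ?thesis using rat_cong_gbinomial_pred[of y] elim p by simp
      qed
    qed
  qed
qed

section \<open>Passage from the congruences to the quotient ring\<close>

theorem theorem3p9: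
  fixes m :: nat and x :: rat
  assumes "m \<ge> 1"
  shows "gamma_K m x =
    gamma_W + indicator {-1} (x + of_nat m) - 1
    + A_of_rat (Harm m - 1) * ell_A (x + of_nat m + 1)
    + (\<Sum>j=0..m-1. A_of_rat ((-1) ^ (m - j) * of_nat (m choose j) / of_nat (m - j))
                      * ell_A (x + of_nat j + 1))"
proof -
  let ?c = "\<lambda>j. (-1) ^ (m - j) * of_nat (m choose j) / of_nat (m - j) :: rat"
  let ?S = "\<lambda>p. fact m * (\<Sum>n=1..p-m-1. (-1) ^ (n - 1) * poly (gregory_poly n) x
                              / pochhammer (of_nat n) (m + 1))"
  let ?R = "\<lambda>p. indicator {-1} (x + of_nat m) - Harm m + wilson_quot p - 1
      + Harm m * fermat_quot p (x + of_nat m + 1)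
      + (\<Sum>j<m. ?c j * fermat_quot p (x + of_nat j + 1))"
  have "A_mod ?S = A_mod ?R"
  proof (rule A_mod_cong)
    have "\<forall>\<^sub>F p in sequentially. m + 2 < p" by (rule eventually_gt_at_top)
    moreover have "\<forall>\<^sub>F p in sequentially. prime p \<longrightarrow> p_integral p x"
      using ev_integral_const unfolding ev_integral_def .
    ultimately show "\<forall>\<^sub>F p in sequentially. prime p \<longrightarrow> rat_cong p (?S p) (?R p)"
      using eventually_gbinomial_pred[of "x + of_nat m"]
    proof eventually_elim
      case (elim p)
      show ?case
      proof
        assume p: "prime p"
        then interpret prime_modulus p by unfold_locales
        have "rat_cong p (?S p) (((x + of_nat m) gchoose (p - 1)) - Harm m + wilson_quot p - 1
            + Harm m * fermat_quot p (x + of_nat m + 1)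
            + (\<Sum>j<m. ?c j * fermat_quot p (x + of_nat j + 1)))"
          by (rule rat_cong_gregory_sum) (use elim p assms in auto)
        also have "rat_cong p \<dots> (?R p)"
          by (intro rat_cong_add rat_cong_diff rat_cong_refl) (use elim p in auto)
        finally show "rat_cong p (?S p) (?R p)" .
      qed
    qed
  qed (intro ev_integral_intros)
  also have "A_mod ?R = A_of_rat (indicator {-1} (x + of_nat m)) - A_of_rat (Harm m) + gamma_W - 1
      + A_of_rat (Harm m) * ell_A (x + of_nat m + 1)
      + (\<Sum>j<m. A_of_rat (?c j) * ell_A (x + of_nat j + 1))"
    unfolding ell_A_altdef gamma_W_altdef
    by (simp only: A_mod_add A_mod_diff A_mod_mult A_mod_sum A_mod_const ev_integral_intros
        A_of_rat_1 A_of_rat_diff)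
  also have "A_of_rat (indicator {-1} (x + of_nat m)) = indicator {-1} (x + of_nat m)"
    by (simp add: indicator_def)
  \<comment> \<open>For m = 0 the truncated subtraction would give {0} on the right.\<close>
  also have "{..<m} = {0..m-1}" using assms by auto
  \<comment> \<open>The H_m in \<open>gamma_K\<close> cancels -H_m, and its -ell(x + m + 1) turns
    the factor H_m into H_m - 1.\<close>
  finally show ?thesis
    unfolding gamma_K_def by (simp add: A_of_rat_diff algebra_simps)
qed

end
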